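(* Let $n\in\mathbb N$ and $\min F_n<c<+\infty$. There exists a threshold $\tau^*(c)>0$, for which the backward Euler–Newton consistency property (C) of the context holds, such that for every $0<\tau<\tau^*(c)$ there exists $\epsilon^*>0$, depending only on $c$ and $\tau$, such that for any $0<\epsilon\le\epsilon^*$ $$F_n(\sigma)-F_n(\Phi_\epsilon(\sigma;\tau))\ge\frac{F_n(\sigma)-F_n(\Phi(\sigma;\tau))}{2}\qquad\text{for all }\sigma\in\mathbb R^N\text{ with }F_n(\sigma)<c.$$
   Context: Let $\Omega=(0,1)^d$ and let $f\in L^\infty(\Omega)$ satisfy $\int_\Omega f\,dx=0$ and $\operatorname{conv}(\operatorname{supp} f)\subset\subset\Omega$. $(\mathcal T^n)_{n\in\mathbb N}$ is a sequence of nested simplicial triangulations of $\Omega$ obtained by successive uniform refinements, $\mathcal T^n=\{T^n_1,\dots,T^n_N\}$ ($N$ depends on $n$). $\mathcal W_n$ is the space of continuous functions on $\Omega$, affine on each simplex of $\mathcal T^{n+1}$, with zero integral over $\Omega$; $\phi_1,\dots,\phi_M$ is a basis of it. $(\delta_n)$ is a monotone sequence of positive reals with $\delta_n\downarrow0$. Put $A^{(i)}=\left(\int_{T_i^n}\nabla\phi_p\cdot\nabla\phi_q\,dx\right)_{p,q}$, $A(\mu)=\sum_{i=1}^N(\mu_i+\delta_n)A^{(i)}$, $\boldsymbol f=\left(\int_\Omega f\phi_p\,dx\right)_p$, $a=(|T_1^n|,\dots,|T_N^n|)$, and $E_n(\mu)=\boldsymbol f^{\,t}A(\mu)^{-1}\boldsymbol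 f+\langle\mu,a\rangle$ for $\mu\in\mathbb R^N_{\ge0}$. For $\sigma\in\mathbb R^N$, $\sigma^{\mathbf 2}:=(\sigma_1^2,\dots,\sigma_N^2)$, $F_n(\sigma):=E_n(\sigma^{\mathbf 2})$, and $G_n(\sigma;\varsigma,\tau):=F_n(\sigma)+\frac{\|\sigma-\varsigma\|^2}{2\tau}$ (Euclidean norm; derivatives of $G_n$ are in the first variable). Newton iterates started at $\sigma$: $\sigma^{(0)}=\sigma$, $\sigma^{(r+1)}=\sigma^{(r)}-[\operatorname{Hess}G_n(\sigma^{(r)};\sigma,\tau)]^{-1}\nabla G_n(\sigma^{(r)};\sigma,\tau)$. Exact step: $\Phi(\sigma;\tau):=\lim_{r\to\infty}\sigma^{(r)}$. Inexact step: $\Phi_\epsilon(\sigma;\tau):=\sigma^{(\hat r)}$, where $\hat r$ is the smallest $r$ such that, for all $i$, $|\partial_iG_n(\sigma^{(r)};\sigma,\tau)|\le\epsilon|\sigma^{(r)}_i-\sigma_i|$ and $\operatorname{sign}\sigma_i^{(r)}=\operatorname{sign}\sigma_i$. Property (C) of $\tau^*(c)$: for every $\sigma^0$ with $F_n(\sigma^0)<c$, $\nabla F_n(\sigma^0)\neq0$ and every $0<\tau<\tau^*(c)$, the sequence $\sigma^{\ell+1}=\Phi(\sigma^\ell;\tau)$ is well defined (all Newton iterates exist and converge), satisfies $\nabla F_n(\sigma^{\ell+1})=-(\sigma^{\ell+1}-\sigma^\ell)/\tau$ for all $\ell$, and $(\sigma^\ell)^{\mathbf 2}$ converges to some element of $\operatorname{argmin}_{\mathbb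 R^N_{\ge0}}E_n$.
   Formalization: In (C) the limit minimizes E_n over nonnegative vectors vanishing where σ^0 does (zero components stay zero, so the full argmin can be unreachable); the inequality is claimed for those σ at which Φ_ε(σ;τ) is defined, since r̂ need not exist for every σ. *)

theory Defs
  imports "HOL-Analysis.Analysis"
begin

section \<open>Partial derivatives\<close>

definition partial :: "'n \<Rightarrow> (real^'n::finite \<Rightarrow> real) \<Rightarrow> real^'n \<Rightarrow> real" where
  "partial i g x = deriv (\<lambda>t. g (x + t *\<^sub>R axis i 1)) 0"

definition grad :: "(real^'n::finite \<Rightarrow> real) \<Rightarrow> real^'n \<Rightarrow> real^'n" where
  "grad g x = (\<chi> i. partial i g x)"

definition hess :: "(real^'n::finite \<Rightarrow> real) \<Rightarrow> real^'n \<Rightarrow> real^'n^'n" where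
  "hess g x = (\<chi> i j. partial i (partial j g) x)"

section \<open>The source term\<close>

definition unit_cube :: "(real^'d::finite) set" where
  "unit_cube = box 0 1"

text \<open>The support is the essential one: the complement of the largest open set on which
  \<open>f\<close> vanishes almost everywhere. Values of \<open>f\<close> outside the cube play no role.\<close>

definition ess_support :: "(real^'d::finite \<Rightarrow> real) \<Rightarrow> (real^'d) set" where
  "ess_support f =
     {x. \<forall>r>0. \<not> (AE y in lebesgue_on (unit_cube \<inter> ball x r). f y = 0)}"

definition admissible_source :: "(real^'d::finite \<Rightarrow> real) \<Rightarrow> bool" where
  "admissible_source f \<longleftrightarrow>
     f \<in> borel_measurable (lebesgue_on unit_cube) \<and>
     (\<exists>C. AE x in lebesgue_on unit_cube. \<bar>f x\<bar> \<le> C) \<and>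
     (LINT x:unit_cube|lebesgue. f x) = 0 \<and>
     closure (convex hull (ess_support f)) \<subseteq> unit_cube"

section \<open>Triangulations and piecewise affine functions\<close>

text \<open>The simplices are closed.\<close>

definition simplicial_triangulation_of_cube :: "(real^'d::finite) set set \<Rightarrow> bool" where
  "simplicial_triangulation_of_cube \<T> \<longleftrightarrow>
     triangulation \<T> \<and> (\<forall>S\<in>\<T>. int CARD('d) simplex S) \<and> \<Union>\<T> = closure unit_cube"

text \<open>Regular (``red'') refinement, independent of the dimension. Every simplex is cut into
  \<open>2 ^ d\<close> simplices of equal volume whose vertices are vertices or edge midpoints of it
  (\<open>midpoint a a = a\<close>), and the half-size copies at its corners are among them. For triangles
  this is the subdivision into four by the edge midpoints; in higher dimension the choice
  of the interior diagonals is left free.\<close>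

definition uniform_refinement :: "(real^'d::finite) set set \<Rightarrow> (real^'d) set set \<Rightarrow> bool" where
  "uniform_refinement \<T> \<T>' \<longleftrightarrow>
     (\<forall>S\<in>\<T>'. \<exists>S0\<in>\<T>. S \<subseteq> S0 \<and>
        {v. v extreme_point_of S} \<subseteq>
          {midpoint a b | a b. a extreme_point_of S0 \<and> b extreme_point_of S0} \<and>
        measure lebesgue S = measure lebesgue S0 / 2 ^ CARD('d)) \<and>
     (\<forall>S0\<in>\<T>. \<forall>v. v extreme_point_of S0 \<longrightarrow> midpoint v ` S0 \<in> \<T>')"

definition uniformly_refined_triangulations :: "(nat \<Rightarrow> (real^'d::finite) set set) \<Rightarrow> bool" where
  "uniformly_refined_triangulations \<T> \<longleftrightarrow>
     (\<forall>k. simplicial_triangulation_of_cube (\<T> k) \<and> uniform_refinement (\<T> k) (\<T> (Suc k)))"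

text \<open>Members are functions on the whole space, but only their values on the cube matter;
  accordingly a basis is one up to equality on the cube.\<close>

definition pw_affine_space :: "(real^'d::finite) set set \<Rightarrow> (real^'d \<Rightarrow> real) set" where
  "pw_affine_space \<T> =
     {w. continuous_on unit_cube w \<and>
         (\<forall>S\<in>\<T>. \<exists>g b. \<forall>x\<in>S \<inter> unit_cube. w x = g \<bullet> x + b) \<and>
         (LINT x:unit_cube|lebesgue. w x) = 0}"

definition basis_on_cube ::
    "('m::finite \<Rightarrow> real^'d::finite \<Rightarrow> real) \<Rightarrow> (real^'d \<Rightarrow> real) set \<Rightarrow> bool" where
  "basis_on_cube \<phi> W \<longleftrightarrow>
     (\<forall>p. \<phi> p \<in> W) \<and>
     (\<forall>w\<in>W. \<exists>!c :: real^'m. \<forall>x\<in>unit_cube. w x = (\<Sum>p\<in>UNIV. c $ p * \<phi> p x))"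

section \<open>The energy\<close>

text \<open>\<open>T\<close> enumerates the simplices of the coarse mesh by \<open>'N\<close>, \<open>\<phi>\<close> the basis by \<open>'m\<close>. The gradient
  of \<open>\<phi> p\<close> exists off the boundaries of the fine simplices, a null set.\<close>

definition local_stiffness ::
    "(real^'d::finite) set \<Rightarrow> ('m::finite \<Rightarrow> real^'d \<Rightarrow> real) \<Rightarrow> real^'m^'m" where
  "local_stiffness S \<phi> = (\<chi> p q. LINT x:S|lebesgue. grad (\<phi> p) x \<bullet> grad (\<phi> q) x)"

definition stiffness ::
    "('N::finite \<Rightarrow> (real^'d::finite) set) \<Rightarrow> ('m::finite \<Rightarrow> real^'d \<Rightarrow> real) \<Rightarrow> real
      \<Rightarrow> real^'N \<Rightarrow> real^'m^'m" where
  "stiffness T \<phi> \<delta> \<mu> = (\<Sum>i\<in>UNIV. (\<mu> $ i + \<delta>) *\<^sub>R local_stiffness (T i) \<phi>)"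

definition load :: "(real^'d::finite \<Rightarrow> real) \<Rightarrow> ('m::finite \<Rightarrow> real^'d \<Rightarrow> real) \<Rightarrow> real^'m" where
  "load f \<phi> = (\<chi> p. LINT x:unit_cube|lebesgue. f x * \<phi> p x)"

definition energy ::
    "(real^'d::finite \<Rightarrow> real) \<Rightarrow> ('N::finite \<Rightarrow> (real^'d) set) \<Rightarrow> ('m::finite \<Rightarrow> real^'d \<Rightarrow> real)
      \<Rightarrow> real \<Rightarrow> real^'N \<Rightarrow> real" where
  "energy f T \<phi> \<delta> \<mu> =
     load f \<phi> \<bullet> (matrix_inv (stiffness T \<phi> \<delta> \<mu>) *v load f \<phi>)
     + \<mu> \<bullet> (\<chi> i. measure lebesgue (T i))"

definition sq :: "real^'N::finite \<Rightarrow> real^'N" where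
  "sq \<sigma> = (\<chi> i. (\<sigma> $ i)\<^sup>2)"

section \<open>Backward Euler steps by Newton iteration\<close>

definition G_fun :: "(real^'N::finite \<Rightarrow> real) \<Rightarrow> real \<Rightarrow> real^'N \<Rightarrow> real^'N \<Rightarrow> real" where
  "G_fun F \<tau> s \<sigma> = F \<sigma> + (norm (\<sigma> - s))\<^sup>2 / (2 * \<tau>)"

primrec newton :: "(real^'N::finite \<Rightarrow> real) \<Rightarrow> real \<Rightarrow> real^'N \<Rightarrow> nat \<Rightarrow> real^'N" where
  "newton F \<tau> \<sigma> 0 = \<sigma>"
| "newton F \<tau> \<sigma> (Suc r) =
     newton F \<tau> \<sigma> r
     - matrix_inv (hess (G_fun F \<tau> \<sigma>) (newton F \<tau> \<sigma> r)) *v grad (G_fun F \<tau> \<sigma>) (newton F \<tau> \<sigma> r)"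

text \<open>\<open>exact_step\<close> is meaningful only under \<open>newton_converges\<close>, and \<open>inexact_step\<close> only under
  \<open>newton_stops\<close>.\<close>

definition newton_converges :: "(real^'N::finite \<Rightarrow> real) \<Rightarrow> real \<Rightarrow> real^'N \<Rightarrow> bool" where
  "newton_converges F \<tau> \<sigma> \<longleftrightarrow>
     (\<forall>r. invertible (hess (G_fun F \<tau> \<sigma>) (newton F \<tau> \<sigma> r))) \<and> convergent (newton F \<tau> \<sigma>)"

definition exact_step :: "(real^'N::finite \<Rightarrow> real) \<Rightarrow> real \<Rightarrow> real^'N \<Rightarrow> real^'N" where
  "exact_step F \<tau> \<sigma> = lim (newton F \<tau> \<sigma>)"

definition stopping_test ::
    "(real^'N::finite \<Rightarrow> real) \<Rightarrow> real \<Rightarrow> real \<Rightarrow> real^'N \<Rightarrow> nat \<Rightarrow> bool" where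
  "stopping_test F \<epsilon> \<tau> \<sigma> r \<longleftrightarrow>
     (\<forall>i. \<bar>partial i (G_fun F \<tau> \<sigma>) (newton F \<tau> \<sigma> r)\<bar> \<le> \<epsilon> * \<bar>newton F \<tau> \<sigma> r $ i - \<sigma> $ i\<bar> \<and>
          sgn (newton F \<tau> \<sigma> r $ i) = sgn (\<sigma> $ i))"

definition newton_stops ::
    "(real^'N::finite \<Rightarrow> real) \<Rightarrow> real \<Rightarrow> real \<Rightarrow> real^'N \<Rightarrow> bool" where
  "newton_stops F \<epsilon> \<tau> \<sigma> \<longleftrightarrow> (\<exists>r. stopping_test F \<epsilon> \<tau> \<sigma> r)"

definition inexact_step ::
    "(real^'N::finite \<Rightarrow> real) \<Rightarrow> real \<Rightarrow> real \<Rightarrow> real^'N \<Rightarrow> real^'N" where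
  "inexact_step F \<epsilon> \<tau> \<sigma> = newton F \<tau> \<sigma> (LEAST r. stopping_test F \<epsilon> \<tau> \<sigma> r)"

text \<open>Components of \<open>\<sigma>0\<close> that vanish stay zero along the whole sequence, because
  \<open>\<lambda>\<sigma>. E (sq \<sigma>)\<close> is even in each component. Its limit is therefore a minimizer
  among the nonnegative vectors that vanish in these components. If no component of \<open>\<sigma>0\<close>
  is zero, or more generally if some minimizer of \<open>E\<close> over the nonnegative orthant vanishes in
  these components, this means a minimizer over the whole orthant. In the remaining case no such
  minimizer can be the limit.\<close>

definition euler_newton_consistent :: "(real^'N::finite \<Rightarrow> real) \<Rightarrow> real \<Rightarrow> real \<Rightarrow> bool" where
  "euler_newton_consistent E c \<tau>s \<longleftrightarrow>
     (let F = (\<lambda>\<sigma>. E (sq \<sigma>)) in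
      \<forall>\<sigma>0 \<tau>. F \<sigma>0 < c \<and> grad F \<sigma>0 \<noteq> 0 \<and> 0 < \<tau> \<and> \<tau> < \<tau>s \<longrightarrow>
        (let s = (\<lambda>l. (exact_step F \<tau> ^^ l) \<sigma>0) in
         (\<forall>l. newton_converges F \<tau> (s l) \<and>
              grad F (s (Suc l)) = - ((s (Suc l) - s l) /\<^sub>R \<tau>)) \<and>
         (\<exists>\<mu>. (\<lambda>l. sq (s l)) \<longlonglongrightarrow> \<mu> \<and>
              is_arg_min E (\<lambda>\<nu>. \<forall>i. 0 \<le> \<nu> $ i \<and> (\<sigma>0 $ i = 0 \<longrightarrow> \<nu> $ i = 0)) \<mu>)))"

end

theory Submission
  imports Defs
begin

text \<open>By Cramer's rule \<open>F\<close> is a rational function without poles, and its sublevel sets are bounded, so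
  its gradient and Hessian are bounded and Lipschitz near \<open>{F < c}\<close>. For small \<open>\<tau>\<close> the Newton map is
  then a contraction of the unit ball around \<open>\<sigma>\<close>, and its fixed point is the backward Euler step.
  As \<open>E\<close> is convex with subgradient \<open>g\<close>, the step reads
  \<open>x\<^sub>i (1 + 2 \<tau> g\<^sub>i) = \<sigma>\<^sub>i\<close>: in the variable \<open>sq \<sigma>\<close> the scheme is an entropic mirror descent, for
  which the Kullback-Leibler divergence from a minimizer decreases by at least \<open>4 \<tau>\<close> times the
  energy gap. This gives convergence of the whole sequence. An iterate that passes the stopping test
  is at distance at most \<open>2 \<tau> \<epsilon> \<parallel>x - \<sigma>\<parallel>\<close> from the exact step \<open>x\<close>, while the exact step lowers
  \<open>F\<close> by at least \<open>\<parallel>x - \<sigma>\<parallel>\<^sup>2 / (2 \<tau>)\<close>.\<close>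

section \<open>Rational functions without poles\<close>

text \<open>Stands in for smoothness: the class is closed under partial derivatives, so one
  induction reaches derivatives of every order, all continuous on the whole space.\<close>

inductive pole_free_rational :: "(real^'n::finite \<Rightarrow> real) \<Rightarrow> bool" where
  const: "pole_free_rational (\<lambda>x. c)"
| coord: "pole_free_rational (\<lambda>x. x $ i)"
| add: "pole_free_rational g \<Longrightarrow> pole_free_rational h \<Longrightarrow> pole_free_rational (\<lambda>x. g x + h x)"
| mult: "pole_free_rational g \<Longrightarrow> pole_free_rational h \<Longrightarrow> pole_free_rational (\<lambda>x. g x * h x)"
| inverse: "pole_free_rational g \<Longrightarrow> \<forall>x. g x \<noteq> 0 \<Longrightarrow> pole_free_rational (\<lambda>x. inverse (g x))"

lemma pole_free_rational_cmult:
  "pole_free_rational g \<Longrightarrow> pole_free_rational (\<lambda>x. c * g x)"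
  by (intro pole_free_rational.intros)

lemma pole_free_rational_minus: "pole_free_rational g \<Longrightarrow> pole_free_rational (\<lambda>x. - g x)"
  using pole_free_rational_cmult[of g "-1"] by simp

lemma pole_free_rational_power: "pole_free_rational g \<Longrightarrow> pole_free_rational (\<lambda>x. g x ^ k)"
  by (induction k) (auto intro: pole_free_rational.intros)

lemma pole_free_rational_divide:
  "pole_free_rational g \<Longrightarrow> pole_free_rational h \<Longrightarrow> \<forall>x. h x \<noteq> 0 \<Longrightarrow>
    pole_free_rational (\<lambda>x. g x / h x)"
  unfolding divide_inverse by (intro pole_free_rational.intros)

lemma pole_free_rational_sum:
  assumes "\<And>i. i \<in> I \<Longrightarrow> pole_free_rational (g i)"
  shows "pole_free_rational (\<lambda>x. \<Sum>i\<in>I. g i x)"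
  using assms by (induction I rule: infinite_finite_induct) (auto intro: pole_free_rational.intros)

lemma pole_free_rational_prod:
  assumes "\<And>i. i \<in> I \<Longrightarrow> pole_free_rational (g i)"
  shows "pole_free_rational (\<lambda>x. \<Prod>i\<in>I. g i x)"
  using assms by (induction I rule: infinite_finite_induct) (auto intro: pole_free_rational.intros)

lemma pole_free_rational_det:
  fixes A :: "real^'n::finite \<Rightarrow> real^'m::finite^'m"
  assumes "\<And>p q. pole_free_rational (\<lambda>x. A x $ p $ q)"
  shows "pole_free_rational (\<lambda>x. det (A x))"
  unfolding det_def
  by (intro pole_free_rational_sum pole_free_rational_prod pole_free_rational.intros assms)

text \<open>The gradient again consists of members of the class, so the lemma can be applied a
  second time to reach the Hessian.\<close>

lemma pole_free_rational_has_derivative: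
  fixes g :: "real^'n::finite \<Rightarrow> real"
  assumes "pole_free_rational g"
  shows "\<exists>g'. (\<forall>i. pole_free_rational (\<lambda>x. g' x $ i)) \<and>
    (\<forall>x. (g has_derivative (\<lambda>h. g' x \<bullet> h)) (at x))"
  using assms
proof induction
  case (const c)
  show ?case
    by (intro exI[of _ "\<lambda>x. 0"]) (auto intro: pole_free_rational.const)
next
  case (coord i)
  have "bounded_linear (\<lambda>h::real^'n. h $ i)"
    by (rule bounded_linear_vec_nth)
  then have "((\<lambda>x::real^'n. x $ i) has_derivative (\<lambda>h. axis i 1 \<bullet> h)) (at x)" for x
    by (simp add: bounded_linear_imp_has_derivative inner_axis')
  then show ?case
    by (intro exI[of _ "\<lambda>x. axis i 1"]) (auto intro: pole_free_rational.const)
next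
  case (add g h)
  then obtain g' h' where
    "\<forall>i. pole_free_rational (\<lambda>x. g' x $ i)" "\<forall>x. (g has_derivative (\<lambda>h. g' x \<bullet> h)) (at x)"
    "\<forall>i. pole_free_rational (\<lambda>x. h' x $ i)" "\<forall>x. (h has_derivative (\<lambda>k. h' x \<bullet> k)) (at x)"
    by blast
  then show ?case
    by (intro exI[of _ "\<lambda>x. g' x + h' x"])
       (auto intro!: pole_free_rational.add derivative_eq_intros simp: inner_add_left)
next
  case (mult g h)
  then obtain g' h' where *:
    "\<forall>i. pole_free_rational (\<lambda>x. g' x $ i)" "\<forall>x. (g has_derivative (\<lambda>h. g' x \<bullet> h)) (at x)"
    "\<forall>i. pole_free_rational (\<lambda>x. h' x $ i)" "\<forall>x. (h has_derivative (\<lambda>k. h' x \<bullet> k)) (at x)"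
    by blast
  have "((\<lambda>x. g x * h x) has_derivative (\<lambda>k. (h x *\<^sub>R g' x + g x *\<^sub>R h' x) \<bullet> k)) (at x)" for x
    by (rule has_derivative_eq_rhs[OF has_derivative_mult[OF *(2)[rule_format] *(4)[rule_format]]])
       (simp add: inner_add_left fun_eq_iff algebra_simps)
  moreover have "pole_free_rational (\<lambda>x. (h x *\<^sub>R g' x + g x *\<^sub>R h' x) $ i)" for i
    using * mult.hyps by (auto intro!: pole_free_rational.intros)
  ultimately show ?case
    by (intro exI[of _ "\<lambda>x. h x *\<^sub>R g' x + g x *\<^sub>R h' x"]) auto
next
  case (inverse g)
  then obtain g' where *:
    "\<forall>i. pole_free_rational (\<lambda>x. g' x $ i)" "\<forall>x. (g has_derivative (\<lambda>h. g' x \<bullet> h)) (at x)"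
    by blast
  have "((\<lambda>x. inverse (g x)) has_derivative
      (\<lambda>k. ((- (inverse (g x) * inverse (g x))) *\<^sub>R g' x) \<bullet> k)) (at x)" for x
    by (rule has_derivative_eq_rhs[OF Deriv.has_derivative_inverse[OF _ *(2)[rule_format]]])
       (use inverse.hyps in \<open>auto simp: fun_eq_iff\<close>)
  moreover have "pole_free_rational (\<lambda>x. ((- (inverse (g x) * inverse (g x))) *\<^sub>R g' x) $ i)" for i
    using * inverse.hyps
    by (auto intro!: pole_free_rational.intros pole_free_rational_minus)
  ultimately show ?case
    by (intro exI[of _ "\<lambda>x. (- (inverse (g x) * inverse (g x))) *\<^sub>R g' x"]) auto
qed

section \<open>Gradients and Hessians of pole-free rational functions\<close>

lemma partial_eqI:
  assumes "(g has_derivative (\<lambda>h. v \<bullet> h)) (at x)"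
  shows "partial i g x = v $ i"
proof -
  have "((\<lambda>t. x + t *\<^sub>R axis i 1) has_derivative (\<lambda>t. t *\<^sub>R axis i 1)) (at (0::real))"
    by (auto intro!: derivative_eq_intros)
  moreover have "(g has_derivative (\<lambda>h. v \<bullet> h)) (at (x + 0 *\<^sub>R axis i 1))"
    using assms by simp
  ultimately have "((\<lambda>t. g (x + t *\<^sub>R axis i 1)) has_derivative (\<lambda>t. v \<bullet> (t *\<^sub>R axis i 1))) (at 0)"
    by (rule has_derivative_compose)
  then have "((\<lambda>t. g (x + t *\<^sub>R axis i 1)) has_field_derivative v $ i) (at 0)"
    by (simp add: has_field_derivative_def inner_axis mult_commute_abs)
  then show ?thesis
    unfolding partial_def by (rule DERIV_imp_deriv)
qed

lemma grad_eqI: "(g has_derivative (\<lambda>h. v \<bullet> h)) (at x) \<Longrightarrow> grad g x = v"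
  by (simp add: grad_def vec_eq_iff partial_eqI)

lemma pole_free_rational_grad:
  assumes "pole_free_rational g"
  shows "(g has_derivative (\<lambda>h. grad g x \<bullet> h)) (at x)"
    and "pole_free_rational (\<lambda>x. grad g x $ i)"
    and "pole_free_rational (partial i g)"
proof -
  obtain g' where *: "\<forall>i. pole_free_rational (\<lambda>x. g' x $ i)"
    "\<forall>x. (g has_derivative (\<lambda>h. g' x \<bullet> h)) (at x)"
    using pole_free_rational_has_derivative[OF assms] by blast
  then have [simp]: "grad g = g'"
    by (auto simp: fun_eq_iff intro: grad_eqI)
  show "(g has_derivative (\<lambda>h. grad g x \<bullet> h)) (at x)" "pole_free_rational (\<lambda>x. grad g x $ i)"
    using * by auto
  have "partial i g = (\<lambda>x. g' x $ i)"
    using *(2) by (auto simp: fun_eq_iff intro: partial_eqI)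
  with * show "pole_free_rational (partial i g)"
    by simp
qed

lemma pole_free_rational_hess:
  "pole_free_rational g \<Longrightarrow> pole_free_rational (\<lambda>x. hess g x $ i $ j)"
  by (simp add: hess_def pole_free_rational_grad(3))

lemma pole_free_rational_continuous_on: "pole_free_rational g \<Longrightarrow> continuous_on S g"
  by (meson continuous_at_imp_continuous_on has_derivative_continuous pole_free_rational_grad(1))

section \<open>Uniform bounds on balls\<close>

text \<open>The gradient is continuous, hence bounded on the compact ball; the ball is convex, so
  the mean value inequality applies.\<close>

lemma pole_free_rational_Lipschitz:
  fixes g :: "real^'n::finite \<Rightarrow> real"
  assumes "pole_free_rational g"
  shows "\<exists>L. \<forall>x\<in>cball 0 R. \<forall>y\<in>cball 0 R. \<bar>g x\<bar> \<le> L \<and> \<bar>g x - g y\<bar> \<le> L * norm (x - y)"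
proof -
  have "continuous_on (cball 0 R) (grad g)"
    by (rule continuous_on_vec_lambda[of _ "\<lambda>i x. grad g x $ i", unfolded vec_lambda_eta])
       (intro pole_free_rational_continuous_on pole_free_rational_grad(2) assms)
  then have "bounded (grad g ` cball 0 R)"
    by (intro compact_imp_bounded compact_continuous_image) auto
  then obtain B where B: "\<And>x. x \<in> cball 0 R \<Longrightarrow> norm (grad g x) \<le> B"
    unfolding bounded_iff by blast
  have "bounded (g ` cball 0 R)"
    by (intro compact_imp_bounded compact_continuous_image pole_free_rational_continuous_on assms) auto
  then obtain C where C: "\<And>x. x \<in> cball 0 R \<Longrightarrow> \<bar>g x\<bar> \<le> C"
    unfolding bounded_iff real_norm_def by blast
  have "\<bar>g x - g y\<bar> \<le> B * norm (x - y)" if "x \<in> cball 0 R" "y \<in> cball 0 R" for x y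
  proof -
    have "norm (g x - g y) \<le> B * norm (x - y)"
    proof (rule differentiable_bound[of "cball 0 R" g "\<lambda>x h. grad g x \<bullet> h"])
      show "(g has_derivative (\<bullet>) (grad g z)) (at z within cball 0 R)" for z
        using pole_free_rational_grad(1)[OF assms] by (rule has_derivative_at_withinI)
      show "onorm ((\<bullet>) (grad g z)) \<le> B" if "z \<in> cball 0 R" for z
        using B[OF that] Cauchy_Schwarz_ineq2[of "grad g z"]
        by (intro onorm_le) (metis mult_right_mono norm_ge_zero order_trans real_norm_def)
    qed (use that in auto)
    then show ?thesis
      by simp
  qed
  moreover have "B * norm (x - y) \<le> max B C * norm (x - y)" for x y :: "real^'n"
    by (intro mult_right_mono) auto
  ultimately have "\<bar>g x\<bar> \<le> max B C \<and> \<bar>g x - g y\<bar> \<le> max B C * norm (x - y)"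
    if "x \<in> cball 0 R" "y \<in> cball 0 R" for x y
    using C[OF that(1)] that by (meson max.coboundedI2 order_trans)
  then show ?thesis
    by blast
qed

text \<open>A crude operator norm bound that turns entrywise estimates of the Hessian into estimates
  of its action on vectors.\<close>

lemma norm_matrix_vector_mult_le_sum:
  fixes A :: "real^'n::finite^'m::finite"
  shows "norm (A *v v) \<le> (\<Sum>i\<in>UNIV. \<Sum>j\<in>UNIV. \<bar>A $ i $ j\<bar>) * norm v"
proof -
  have "norm (A *v v) \<le> (\<Sum>i\<in>UNIV. \<bar>(A *v v) $ i\<bar>)"
    by (rule norm_le_l1_cart)
  also have "\<dots> \<le> (\<Sum>i\<in>UNIV. \<Sum>j\<in>UNIV. \<bar>A $ i $ j\<bar> * norm v)"
    by (intro sum_mono)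
       (auto simp: matrix_vector_mult_def abs_mult component_le_norm_cart
         intro!: order_trans[OF sum_abs] sum_mono mult_left_mono)
  finally show ?thesis
    by (simp add: sum_distrib_right)
qed

lemma pole_free_rational_bounds:
  fixes F :: "real^'n::finite \<Rightarrow> real"
  assumes F: "pole_free_rational F"
  shows "\<exists>M>0. \<forall>x\<in>cball 0 R. \<forall>y\<in>cball 0 R. \<forall>v.
    norm (grad F x) \<le> M \<and> norm (grad F x - grad F y) \<le> M * norm (x - y) \<and>
    norm (hess F x *v v) \<le> M * norm v \<and>
    norm ((hess F x - hess F y) *v v) \<le> M * norm (x - y) * norm v"
proof -
  obtain L where L: "\<And>i x y. x \<in> cball 0 R \<Longrightarrow> y \<in> cball 0 R \<Longrightarrow>
      \<bar>grad F x $ i\<bar> \<le> L i \<and> \<bar>grad F x $ i - grad F y $ i\<bar> \<le> L i * norm (x - y)"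
    using pole_free_rational_Lipschitz[OF pole_free_rational_grad(2)[OF F]] by metis
  obtain N where N: "\<And>i j x y. x \<in> cball 0 R \<Longrightarrow> y \<in> cball 0 R \<Longrightarrow>
      \<bar>hess F x $ i $ j\<bar> \<le> N i j \<and> \<bar>hess F x $ i $ j - hess F y $ i $ j\<bar> \<le> N i j * norm (x - y)"
    using pole_free_rational_Lipschitz[OF pole_free_rational_hess[OF F]] by metis
  define GL where "GL = (\<Sum>i\<in>UNIV. L i)"
  define HL where "HL = (\<Sum>i\<in>UNIV. \<Sum>j\<in>UNIV. N i j)"
  \<comment> \<open>The maximum with 1 makes the common constant positive.\<close>
  define M where "M = max 1 (max GL HL)"
  have 1: "norm (grad F x) \<le> M" if "x \<in> cball 0 R" for x
  proof -
    have "norm (grad F x) \<le> GL"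
      unfolding GL_def using L that by (intro order_trans[OF norm_le_l1_cart] sum_mono) blast
    then show ?thesis
      by (simp add: M_def)
  qed
  have 2: "norm (grad F x - grad F y) \<le> M * norm (x - y)"
    if "x \<in> cball 0 R" "y \<in> cball 0 R" for x y
  proof -
    have "norm (grad F x - grad F y) \<le> GL * norm (x - y)"
      unfolding GL_def sum_distrib_right
      using L that by (intro order_trans[OF norm_le_l1_cart] sum_mono) auto
    also have "\<dots> \<le> M * norm (x - y)"
      by (intro mult_right_mono) (auto simp: M_def)
    finally show ?thesis .
  qed
  have 3: "norm (hess F x *v v) \<le> M * norm v" if "x \<in> cball 0 R" for x v
  proof -
    have "(\<Sum>i\<in>UNIV. \<Sum>j\<in>UNIV. \<bar>hess F x $ i $ j\<bar>) \<le> HL"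
      unfolding HL_def using N that by (intro sum_mono) blast
    also have "\<dots> \<le> M"
      by (simp add: M_def)
    finally show ?thesis
      by (intro order_trans[OF norm_matrix_vector_mult_le_sum] mult_right_mono) auto
  qed
  have 4: "norm ((hess F x - hess F y) *v v) \<le> M * norm (x - y) * norm v"
    if "x \<in> cball 0 R" "y \<in> cball 0 R" for x y v
  proof -
    have "(\<Sum>i\<in>UNIV. \<Sum>j\<in>UNIV. \<bar>(hess F x - hess F y) $ i $ j\<bar>) \<le> HL * norm (x - y)"
      unfolding HL_def sum_distrib_right using N that by (intro sum_mono) auto
    also have "\<dots> \<le> M * norm (x - y)"
      by (intro mult_right_mono) (auto simp: M_def)
    finally show ?thesis
      by (intro order_trans[OF norm_matrix_vector_mult_le_sum] mult_right_mono) auto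
  qed
  show ?thesis
    using 1 2 3 4 by (intro exI[of _ M]) (auto simp: M_def)
qed

lemma matrix_inv_right:
  fixes A :: "real^'n::finite^'n"
  assumes "invertible A"
  shows "A ** matrix_inv A = mat 1"
  using someI_ex[OF assms[unfolded invertible_def]] by (auto simp: matrix_inv_def)

section \<open>Newton's method for a backward Euler step\<close>

lemma grad_G_fun:
  assumes "pole_free_rational F"
  shows "grad (G_fun F \<tau> s) x = grad F x + (1 / \<tau>) *\<^sub>R (x - s)"
proof (rule grad_eqI)
  have "((\<lambda>x. (x - s) \<bullet> (x - s)) has_derivative (\<lambda>h. 2 * ((x - s) \<bullet> h))) (at x)"
    by (auto intro!: derivative_eq_intros simp: inner_commute)
  from has_derivative_add[OF pole_free_rational_grad(1)[OF assms]
      has_derivative_mult_right[OF this, of "1 / (2 * \<tau>)"]]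
  show "(G_fun F \<tau> s has_derivative (\<bullet>) (grad F x + (1 / \<tau>) *\<^sub>R (x - s))) (at x)"
    by (simp add: G_fun_def[abs_def] power2_norm_eq_inner inner_add_left[abs_def])
qed

lemma hess_G_fun:
  assumes "pole_free_rational F"
  shows "hess (G_fun F \<tau> s) x = hess F x + (1 / \<tau>) *\<^sub>R mat 1"
proof -
  have "partial i (partial j (G_fun F \<tau> s)) x
      = partial i (partial j F) x + (1 / \<tau>) * (if i = j then 1 else 0)" for i j
  proof -
    have eq: "partial j (G_fun F \<tau> s) = (\<lambda>x. partial j F x + (1 / \<tau>) * (axis j 1 \<bullet> (x - s)))"
      using grad_G_fun[OF assms, of \<tau> s]
      by (simp add: fun_eq_iff grad_def vec_eq_iff inner_axis')
    have "((\<lambda>x. axis j 1 \<bullet> (x - s)) has_derivative (\<lambda>h. axis j 1 \<bullet> h)) (at x)"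
      by (auto intro!: derivative_eq_intros)
    from has_derivative_add[OF
        pole_free_rational_grad(1)[OF pole_free_rational_grad(3)[OF assms]]
        has_derivative_mult_right[OF this, of "1 / \<tau>"]]
    have "(partial j (G_fun F \<tau> s) has_derivative
        (\<bullet>) (grad (partial j F) x + (1 / \<tau>) *\<^sub>R axis j 1)) (at x)"
      unfolding eq by (simp add: inner_add_left[abs_def])
    then have "partial i (partial j (G_fun F \<tau> s)) x
        = (grad (partial j F) x + (1 / \<tau>) *\<^sub>R axis j 1) $ i"
      by (rule partial_eqI)
    then show ?thesis
      by (simp add: grad_def axis_def)
  qed
  then show ?thesis
    by (simp add: hess_def vec_eq_iff mat_def)
qed

text \<open>The bounds are required on radius \<open>R + 1\<close> because Newton iterates started
  in the ball of radius \<open>R\<close> stay within distance 1 of their starting point.\<close>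

locale newton_bounds =
  fixes F :: "real^'n::finite \<Rightarrow> real" and R M :: real
  assumes rational: "pole_free_rational F"
    and M_pos: "0 < M"
    and grad_bound: "x \<in> cball 0 (R + 1) \<Longrightarrow> norm (grad F x) \<le> M"
    and grad_Lipschitz: "x \<in> cball 0 (R + 1) \<Longrightarrow> y \<in> cball 0 (R + 1) \<Longrightarrow>
      norm (grad F x - grad F y) \<le> M * norm (x - y)"
    and hess_bound: "x \<in> cball 0 (R + 1) \<Longrightarrow> norm (hess F x *v v) \<le> M * norm v"
    and hess_Lipschitz: "x \<in> cball 0 (R + 1) \<Longrightarrow> y \<in> cball 0 (R + 1) \<Longrightarrow>
      norm ((hess F x - hess F y) *v v) \<le> M * norm (x - y) * norm v"
begin

text \<open>The gradient changes by at most \<open>M * norm (y - x)\<close> along the segment from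
  \<open>x\<close> to \<open>y\<close>; the mean value inequality then gives the quadratic
  remainder.\<close>

lemma linearization:
  assumes x: "x \<in> cball 0 (R + 1)" and y: "y \<in> cball 0 (R + 1)"
  shows "\<bar>F y - F x - grad F x \<bullet> (y - x)\<bar> \<le> M * (norm (y - x))\<^sup>2"
proof -
  have sub: "closed_segment x y \<subseteq> cball 0 (R + 1)"
    using x y by (intro closed_segment_subset) auto
  have "norm (F y - F x - grad F x \<bullet> (y - x)) \<le> norm (y - x) * (M * norm (y - x))"
  proof (rule differentiable_bound_linearization[of x y "closed_segment x y" F "\<lambda>z h. grad F z \<bullet> h"])
    show "x + t *\<^sub>R (y - x) \<in> closed_segment x y" if "t \<in> {0..1}" for t
      using that by (auto simp: closed_segment_def algebra_simps intro!: exI[of _ t])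
    show "(F has_derivative (\<bullet>) (grad F z)) (at z within closed_segment x y)" for z
      using pole_free_rational_grad(1)[OF rational] by (rule has_derivative_at_withinI)
    show "onorm ((\<bullet>) (grad F z) - (\<bullet>) (grad F x)) \<le> M * norm (y - x)"
      if z: "z \<in> closed_segment x y" for z
      unfolding fun_diff_def
    proof (rule onorm_le)
      fix h
      have "norm (grad F z \<bullet> h - grad F x \<bullet> h) \<le> norm (grad F z - grad F x) * norm h"
        using Cauchy_Schwarz_ineq2[of "grad F z - grad F x" h] by (simp add: inner_diff_left)
      also have "\<dots> \<le> M * norm (y - x) * norm h"
      proof (rule mult_right_mono)
        have "norm (grad F z - grad F x) \<le> M * norm (z - x)"
          using grad_Lipschitz x z sub by blast
        also have "\<dots> \<le> M * norm (y - x)"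
          using M_pos segment_bound1[OF z] by (intro mult_left_mono) auto
        finally show "norm (grad F z - grad F x) \<le> M * norm (y - x)" .
      qed auto
      finally show "norm (grad F z \<bullet> h - grad F x \<bullet> h) \<le> M * norm (y - x) * norm h" .
    qed
  qed auto
  then show ?thesis
    by (simp add: power2_eq_square mult_ac)
qed

text \<open>For \<open>16 * (\<tau> * M) \<le> 1\<close> the quadratic penalty dominates the Hessian
  of \<open>F\<close>. This makes the Newton map well defined, lets it preserve the unit ball around
  \<open>s\<close>, and gives it contraction factor 1/2 there.\<close>

context
  fixes \<tau> :: real and s :: "real^'n"
  assumes \<tau>: "0 < \<tau>" "16 * (\<tau> * M) \<le> 1" and s: "s \<in> cball 0 R"
begin

lemma cball_step_subset: "cball s 1 \<subseteq> cball 0 (R + 1)"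
  using s by (simp add: cball_subset_cball_iff)

text \<open>A kernel vector \<open>v\<close> would make \<open>hess F x\<close> act on it as
  multiplication by \<open>- 1 / \<tau>\<close>, which its bound \<open>M\<close> forbids unless
  \<open>v = 0\<close>.\<close>

lemma hess_G_fun_invertible:
  assumes "x \<in> cball 0 (R + 1)"
  shows "invertible (hess (G_fun F \<tau> s) x)"
proof -
  have "v = 0" if "hess (G_fun F \<tau> s) x *v v = 0" for v
  proof -
    have "hess F x *v v = - ((1 / \<tau>) *\<^sub>R v)"
      using that by (simp add: hess_G_fun rational matrix_vector_mult_add_rdistrib
          eq_neg_iff_add_eq_0 flip: scaleR_matrix_vector_assoc)
    then have "norm v / \<tau> \<le> M * norm v"
      using hess_bound[OF assms, of v] \<tau> by simp
    then have "norm v \<le> (\<tau> * M) * norm v"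
      using \<tau> by (simp add: field_simps)
    also have "\<dots> \<le> (1 / 16) * norm v"
      using \<tau> by (intro mult_right_mono) auto
    finally show "v = 0"
      by simp
  qed
  then show ?thesis
    by (auto simp: invertible_left_inverse matrix_left_invertible_ker)
qed

section \<open>The Newton map and its fixed point\<close>

definition newton_map :: "real^'n \<Rightarrow> real^'n" where
  "newton_map x = x - matrix_inv (hess (G_fun F \<tau> s) x) *v grad (G_fun F \<tau> s) x"

text \<open>Multiplying the Newton equation by \<open>\<tau>\<close> times the Hessian removes the
  inverse matrix. The price is that the new iterate occurs on both sides; in the later estimates it
  is absorbed because \<open>\<tau> * M\<close> is small.\<close>

lemma newton_map_implicit:
  assumes "x \<in> cball 0 (R + 1)"
  shows "newton_map x = s + \<tau> *\<^sub>R (hess F x *v (x - newton_map x) - grad F x)"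
proof -
  let ?H = "hess (G_fun F \<tau> s) x"
  have "?H *v (x - newton_map x) = (?H ** matrix_inv ?H) *v grad (G_fun F \<tau> s) x"
    by (simp add: newton_map_def matrix_vector_mul_assoc)
  also have "\<dots> = grad (G_fun F \<tau> s) x"
    using hess_G_fun_invertible[OF assms] by (simp add: matrix_inv_right)
  finally have "\<tau> *\<^sub>R (hess F x *v (x - newton_map x) + (1 / \<tau>) *\<^sub>R (x - newton_map x))
      = \<tau> *\<^sub>R (grad F x + (1 / \<tau>) *\<^sub>R (x - s))"
    by (simp add: hess_G_fun grad_G_fun rational matrix_vector_mult_add_rdistrib
        flip: scaleR_matrix_vector_assoc)
  then show ?thesis
    using \<tau> by (simp add: algebra_simps)
qed

lemma newton_map_in_cball:
  assumes "x \<in> cball s 1"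
  shows "newton_map x \<in> cball s 1"
proof -
  let ?z = "newton_map x"
  have x: "x \<in> cball 0 (R + 1)"
    using assms cball_step_subset by blast
  have "norm (x - ?z) \<le> norm (x - s) + norm (?z - s)"
    using norm_triangle_ineq4[of "x - s" "?z - s"] by simp
  then have *: "norm (x - ?z) \<le> 1 + norm (?z - s)"
    using assms by (simp add: dist_norm norm_minus_commute)
  have "?z - s = \<tau> *\<^sub>R (hess F x *v (x - ?z) - grad F x)"
    using newton_map_implicit[OF x] by (metis add_diff_cancel_left')
  then have "norm (?z - s) = \<tau> * norm (hess F x *v (x - ?z) - grad F x)"
    using \<tau> by (metis abs_of_pos norm_scaleR)
  also have "\<dots> \<le> \<tau> * (M * norm (x - ?z) + M)"
    using \<tau> hess_bound[OF x, of "x - ?z"] grad_bound[OF x]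
    by (intro mult_left_mono order_trans[OF norm_triangle_ineq4] add_mono) auto
  also have "\<dots> \<le> \<tau> * (M * (1 + norm (?z - s)) + M)"
    using \<tau> M_pos * by (intro mult_left_mono add_right_mono) auto
  also have "\<dots> = (\<tau> * M) * (2 + norm (?z - s))"
    by (simp add: algebra_simps)
  also have "\<dots> \<le> (1 / 16) * (2 + norm (?z - s))"
    using \<tau> by (intro mult_right_mono) auto
  finally show ?thesis
    by (simp add: dist_norm norm_minus_commute)
qed

text \<open>Subtract the two implicit equations. The Hessian difference acts on
  \<open>y - newton_map y\<close>, of norm at most 2 since both points lie in the unit ball, so
  three terms contribute 1 + 2 + 1 = 4 multiples of \<open>norm (x - y)\<close>.\<close>

lemma newton_map_contraction:
  assumes x: "x \<in> cball s 1" and y: "y \<in> cball s 1"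
  shows "norm (newton_map x - newton_map y) \<le> (1 / 2) * norm (x - y)"
proof -
  let ?z = "newton_map x" and ?w = "newton_map y"
  have x': "x \<in> cball 0 (R + 1)" and y': "y \<in> cball 0 (R + 1)"
    using x y cball_step_subset by blast+
  have "dist y ?w \<le> dist s y + dist s ?w"
    by (metis dist_commute dist_triangle2)
  then have yw: "norm (y - ?w) \<le> 2"
    using y newton_map_in_cball[OF y] by (simp add: dist_norm)
  have "?z - ?w = \<tau> *\<^sub>R (hess F x *v ((x - y) - (?z - ?w)) + (hess F x - hess F y) *v (y - ?w)
      - (grad F x - grad F y))" (is "_ = \<tau> *\<^sub>R (?a + ?b - ?c)")
    by (subst newton_map_implicit[OF x'], subst newton_map_implicit[OF y'])
       (simp add: algebra_simps matrix_vector_mult_diff_rdistrib matrix_vector_mult_diff_distrib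
         matrix_vector_right_distrib)
  then have eq: "norm (?z - ?w) = \<tau> * norm (?a + ?b - ?c)"
    using \<tau> by (metis abs_of_pos norm_scaleR)
  have "norm (?a + ?b - ?c) \<le> M * (norm (x - y) + norm (?z - ?w))
      + M * norm (x - y) * 2 + M * norm (x - y)"
  proof (rule order_trans[OF norm_triangle_ineq4], rule add_mono,
      rule order_trans[OF norm_triangle_ineq], rule add_mono)
    show "norm ?a \<le> M * (norm (x - y) + norm (?z - ?w))"
      using M_pos
      by (intro order_trans[OF hess_bound[OF x']] mult_left_mono norm_triangle_ineq4) auto
    show "norm ?b \<le> M * norm (x - y) * 2"
      using M_pos yw by (intro order_trans[OF hess_Lipschitz[OF x' y']] mult_left_mono) auto
  qed (rule grad_Lipschitz[OF x' y'])
  then have "norm (?z - ?w) \<le> \<tau> * (M * (norm (x - y) + norm (?z - ?w))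
      + M * norm (x - y) * 2 + M * norm (x - y))"
    unfolding eq using \<tau> by (intro mult_left_mono) (auto simp flip: eq)
  also have "\<dots> = (\<tau> * M) * (4 * norm (x - y) + norm (?z - ?w))"
    by (simp add: algebra_simps)
  also have "\<dots> \<le> (1 / 16) * (4 * norm (x - y) + norm (?z - ?w))"
    using \<tau> by (intro mult_right_mono) auto
  finally have le: "norm (?z - ?w) \<le> (1 / 16) * (4 * norm (x - y) + norm (?z - ?w))" .
  \<comment> \<open>Absorbing \<open>a\<close> leaves \<open>15 * a \<le> 4 * b\<close>, slightly
    better than the stated factor.\<close>
  have "a \<le> (1 / 2) * b" if "a \<le> (1 / 16) * (4 * b + a)" "0 \<le> b" for a b :: real
    using that by simp
  from this[OF le norm_ge_zero] show ?thesis .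
qed

lemma newton_Suc_map: "newton F \<tau> s (Suc r) = newton_map (newton F \<tau> s r)"
  by (simp add: newton_map_def)

lemma newton_in_cball: "newton F \<tau> s r \<in> cball s 1"
  by (induction r) (auto simp only: newton_Suc_map newton.simps(1) newton_map_in_cball centre_in_cball)

text \<open>Banach's theorem gives a fixed point of the Newton map, approached at rate
  \<open>(1 / 2) ^ r\<close>. At a fixed point the Hessian term of the implicit equation vanishes,
  and what remains is the backward Euler equation.\<close>

lemma newton_converges_and_limit:
  shows "newton_converges F \<tau> s"
    and "exact_step F \<tau> s \<in> cball s 1"
    and "exact_step F \<tau> s = s - \<tau> *\<^sub>R grad F (exact_step F \<tau> s)"
proof -
  have "\<exists>!x. x \<in> cball s 1 \<and> newton_map x = x"
    using newton_map_in_cball newton_map_contraction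
    by (intro Banach_fix[where c = "1 / 2"]) (auto simp: dist_norm complete_eq_closed)
  then obtain x where x: "x \<in> cball s 1" "newton_map x = x"
    by blast
  have "norm (newton F \<tau> s r - x) \<le> (1 / 2) ^ r * norm (s - x)" for r
  proof (induction r)
    case (Suc r)
    have "norm (newton F \<tau> s (Suc r) - x) \<le> (1 / 2) * norm (newton F \<tau> s r - x)"
      using newton_map_contraction[OF newton_in_cball x(1), of r] x(2) by (simp only: newton_Suc_map)
    with Suc show ?case
      by simp
  qed simp
  then have bound: "\<forall>\<^sub>F r in sequentially. norm (newton F \<tau> s r - x) \<le> (1 / 2) ^ r * norm (s - x)"
    by (intro always_eventually allI)
  have "(\<lambda>r. (1 / 2) ^ r * norm (s - x)) \<longlonglongrightarrow> 0"
    by (intro tendsto_mult_left_zero LIMSEQ_power_zero) auto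
  from Lim_null_comparison[OF bound this]
  have lim: "newton F \<tau> s \<longlonglongrightarrow> x"
    by (simp add: LIM_zero_iff)
  then show "newton_converges F \<tau> s"
    using hess_G_fun_invertible[OF subsetD[OF cball_step_subset newton_in_cball]]
    by (auto simp: newton_converges_def convergent_def)
  have "exact_step F \<tau> s = x"
    unfolding exact_step_def using lim by (rule limI)
  moreover have "x = s + \<tau> *\<^sub>R (hess F x *v (x - x) - grad F x)"
    using newton_map_implicit[of x, unfolded x(2)] subsetD[OF cball_step_subset x(1)] by blast
  moreover have "s + \<tau> *\<^sub>R (hess F x *v (x - x) - grad F x) = s - \<tau> *\<^sub>R grad F x"
    by simp
  ultimately show "exact_step F \<tau> s \<in> cball s 1"
    and "exact_step F \<tau> s = s - \<tau> *\<^sub>R grad F (exact_step F \<tau> s)"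
    using x(1) by argo+
qed

section \<open>Energy decrease of exact and inexact steps\<close>

text \<open>Linearize at the end point of the step, where the gradient is known to be
  \<open>(s - x) / \<tau>\<close>. The linear term gains
  \<open>(norm (s - x))\<^sup>2 / \<tau>\<close>, and the remainder costs at most half of
  it.\<close>

lemma exact_step_descent:
  "(norm (exact_step F \<tau> s - s))\<^sup>2 / (2 * \<tau>) \<le> F s - F (exact_step F \<tau> s)"
proof -
  let ?x = "exact_step F \<tau> s"
  have x: "?x \<in> cball 0 (R + 1)" and s': "s \<in> cball 0 (R + 1)"
    using newton_converges_and_limit(2) s cball_step_subset by auto
  \<comment> \<open>The Euler equation has the exact step on both sides; rearranging it for abstract
    vectors avoids rewriting in a loop.\<close>
  have "y = s - z" if "z = s - y" for y z
    using that by simp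
  then have "\<tau> *\<^sub>R grad F ?x = s - ?x"
    using newton_converges_and_limit(3) by blast
  then have "\<tau> * (grad F ?x \<bullet> (s - ?x)) = (norm (s - ?x))\<^sup>2"
    by (metis inner_scaleR_left power2_norm_eq_inner)
  then have "grad F ?x \<bullet> (s - ?x) = (norm (s - ?x))\<^sup>2 / \<tau>"
    using \<tau> by (simp add: field_simps)
  moreover have "M * (norm (s - ?x))\<^sup>2 \<le> (1 / (2 * \<tau>)) * (norm (s - ?x))\<^sup>2"
    using \<tau> by (intro mult_right_mono) (auto simp: field_simps)
  ultimately have "(norm (s - ?x))\<^sup>2 / \<tau> - (norm (s - ?x))\<^sup>2 / (2 * \<tau>) \<le> F s - F ?x"
    using linearization[OF x s'] by auto
  then show ?thesis
    by (simp add: norm_minus_commute field_simps)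
qed

text \<open>With \<open>D\<close> the length of the exact step and \<open>d\<close> the distance of
  \<open>z\<close> from its end point, the residual bound forces \<open>d\<close> to be a small
  multiple of \<open>D\<close>. The energy lost by using \<open>z\<close> is then at most
  \<open>D\<^sup>2 / (4 * \<tau>)\<close>, half of the decrease guaranteed for the exact
  step.\<close>

lemma small_residual_descent:
  assumes z: "z \<in> cball s 1" and \<epsilon>: "0 < \<epsilon>" "12 * (\<tau> * \<epsilon>) \<le> 1"
    and residual: "\<And>i. \<bar>grad (G_fun F \<tau> s) z $ i\<bar> \<le> \<epsilon> * \<bar>z $ i - s $ i\<bar>"
  shows "(F s - F (exact_step F \<tau> s)) / 2 \<le> F s - F z"
proof -
  let ?x = "exact_step F \<tau> s"
  define d D where "d = norm (z - ?x)" and "D = norm (?x - s)"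
  have nonneg: "0 \<le> d" "0 \<le> D"
    by (simp_all add: d_def D_def)
  have x: "?x \<in> cball 0 (R + 1)" and z': "z \<in> cball 0 (R + 1)"
    using newton_converges_and_limit(2) z cball_step_subset by auto
  have "y = s - w" if "w = s - y" for y w
    using that by simp
  then have gx: "\<tau> *\<^sub>R grad F ?x = s - ?x"
    using newton_converges_and_limit(3) by blast
  define e where "e = grad F z + (1 / \<tau>) *\<^sub>R (z - s)"
  have "norm e \<le> norm (\<epsilon> *\<^sub>R (z - s))"
    using residual \<epsilon>
    by (intro norm_le_componentwise_cart) (simp add: grad_G_fun rational e_def abs_mult)
  also have "\<dots> \<le> \<epsilon> * (d + D)"
    using \<epsilon> norm_triangle_ineq[of "z - ?x" "?x - s"] by (simp add: d_def D_def)
  finally have e: "norm e \<le> \<epsilon> * (d + D)" .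
  have "\<tau> *\<^sub>R e = \<tau> *\<^sub>R grad F z + (z - s)"
    using \<tau> by (simp add: e_def algebra_simps)
  \<comment> \<open>Difference of the perturbed Euler equation for \<open>z\<close> and the exact
    one.\<close>
  then have "z - ?x = \<tau> *\<^sub>R e - \<tau> *\<^sub>R (grad F z - grad F ?x)"
    by (simp add: scaleR_diff_right gx)
  then have "d \<le> norm (\<tau> *\<^sub>R e) + norm (\<tau> *\<^sub>R (grad F z - grad F ?x))"
    unfolding d_def by (metis norm_triangle_ineq4)
  also have "\<dots> = \<tau> * norm e + \<tau> * norm (grad F z - grad F ?x)"
    using \<tau> by simp
  also have "\<dots> \<le> \<tau> * (\<epsilon> * (d + D)) + \<tau> * (M * d)"
    using \<tau> e grad_Lipschitz[OF z' x] by (intro add_mono mult_left_mono) (auto simp: d_def)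
  also have "\<dots> = (\<tau> * \<epsilon>) * d + (\<tau> * \<epsilon>) * D + (\<tau> * M) * d"
    by (simp add: algebra_simps)
  also have "\<dots> \<le> (1 / 12) * d + (\<tau> * \<epsilon>) * D + (1 / 16) * d"
    using \<tau> \<epsilon> nonneg by (intro add_mono mult_right_mono) auto
  \<comment> \<open>Absorbing 1/12 + 1/16 = 7/48 of \<open>d\<close> leaves a factor 48/41, rounded
    up to 2.\<close>
  finally have d: "d \<le> 2 * (\<tau> * \<epsilon>) * D"
    using nonneg by linarith
  have "F z - F ?x \<le> grad F ?x \<bullet> (z - ?x) + M * d\<^sup>2"
    using linearization[OF x z'] by (simp add: d_def abs_le_iff)
  also have "grad F ?x \<bullet> (z - ?x) \<le> (D / \<tau>) * d"
  proof -
    have "\<tau> * norm (grad F ?x) = D"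
      using arg_cong[OF gx, of norm] \<tau> by (simp add: D_def norm_minus_commute)
    then have "norm (grad F ?x) = D / \<tau>"
      using \<tau> by (simp add: field_simps)
    then show ?thesis
      using norm_cauchy_schwarz[of "grad F ?x" "z - ?x"] by (simp add: d_def)
  qed
  also have "(D / \<tau>) * d + M * d\<^sup>2 \<le> (D / \<tau>) * (2 * (\<tau> * \<epsilon>) * D) + M * (2 * (\<tau> * \<epsilon>) * D)\<^sup>2"
    using d nonneg \<tau> M_pos by (intro add_mono mult_left_mono power_mono) auto
  also have "\<dots> = (2 * (\<tau> * \<epsilon>) + 4 * (\<tau> * M) * (\<tau> * \<epsilon>) * (\<tau> * \<epsilon>)) * (D\<^sup>2 / \<tau>)"
    using \<tau> by (simp add: power2_eq_square field_simps)
  \<comment> \<open>The two contributions are at most 1/6 and 1/576.\<close>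
  also have "\<dots> \<le> (1 / 4) * (D\<^sup>2 / \<tau>)"
  proof (rule mult_right_mono)
    have "(\<tau> * M) * (\<tau> * \<epsilon>) * (\<tau> * \<epsilon>) \<le> (1 / 16) * (1 / 12) * (1 / 12)"
      using \<tau> \<epsilon> M_pos by (intro mult_mono) auto
    then show "2 * (\<tau> * \<epsilon>) + 4 * (\<tau> * M) * (\<tau> * \<epsilon>) * (\<tau> * \<epsilon>) \<le> 1 / 4"
      using \<epsilon> by linarith
  qed (use \<tau> in auto)
  also have "\<dots> \<le> (F s - F ?x) / 2"
    using exact_step_descent by (simp add: D_def)
  finally show ?thesis
    by (simp add: field_simps)
qed

lemma inexact_step_descent:
  assumes "0 < \<epsilon>" "12 * (\<tau> * \<epsilon>) \<le> 1" and "newton_stops F \<epsilon> \<tau> s"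
  shows "(F s - F (exact_step F \<tau> s)) / 2 \<le> F s - F (inexact_step F \<epsilon> \<tau> s)"
proof -
  define r where "r = (LEAST r. stopping_test F \<epsilon> \<tau> s r)"
  have "stopping_test F \<epsilon> \<tau> s r"
    using assms(3) unfolding newton_stops_def r_def by (rule LeastI_ex)
  then have "(F s - F (exact_step F \<tau> s)) / 2 \<le> F s - F (newton F \<tau> s r)"
    using assms by (intro small_residual_descent newton_in_cball) (auto simp: stopping_test_def grad_def)
  then show ?thesis
    by (simp add: inexact_step_def r_def)
qed

end

end

section \<open>Convex energies composed with the componentwise square\<close>

lemma sq_nonneg: "0 \<le> sq \<sigma> $ i"
  by (simp add: sq_def)

section \<open>Kullback-Leibler divergence in the squared variable\<close>

text \<open>The generalized Kullback-Leibler divergence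
  \<open>\<Sum>i. m ln (m / s\<^sup>2) - m + s\<^sup>2\<close>. A coordinate with
  \<open>m $ i = 0\<close> contributes just its square, whatever value the logarithms take.\<close>

definition bregman :: "real^'N::finite \<Rightarrow> real^'N \<Rightarrow> real" where
  "bregman m s = (\<Sum>i\<in>UNIV. (s $ i)\<^sup>2 - m $ i - m $ i * (ln ((s $ i)\<^sup>2) - ln (m $ i)))"

text \<open>With \<open>t = \<bar>s\<bar> / sqrt m\<close>, the inequality
  \<open>ln t \<le> t - 1\<close> leaves exactly \<open>m * (t - 1)\<^sup>2\<close>. Thus the
  divergence dominates the squared Hellinger distance, and its decay to 0 implies coordinatewise
  convergence.\<close>

lemma bregman_term_lower:
  fixes m s :: real
  assumes "0 \<le> m" and "m \<noteq> 0 \<Longrightarrow> s \<noteq> 0"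
  shows "(\<bar>s\<bar> - sqrt m)\<^sup>2 \<le> s\<^sup>2 - m - m * (ln (s\<^sup>2) - ln m)"
proof (cases "m = 0")
  case False
  then have m: "0 < m" and s: "0 < \<bar>s\<bar>"
    using assms by auto
  define t where "t = \<bar>s\<bar> / sqrt m"
  have t: "0 < t" "\<bar>s\<bar> = t * sqrt m"
    using m s by (simp_all add: t_def)
  have s2: "s\<^sup>2 = t\<^sup>2 * m"
    using m by (simp add: power_mult_distrib t(2) flip: power2_abs[of s])
  have "ln (s\<^sup>2) - ln m = 2 * ln t"
    using m t(1) by (simp add: s2 ln_mult ln_realpow)
  also have "\<dots> \<le> 2 * (t - 1)"
    using ln_le_minus_one[OF t(1)] by simp
  finally have "m * (ln (s\<^sup>2) - ln m) \<le> m * (2 * (t - 1))"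
    using m by (intro mult_left_mono) auto
  moreover have "(\<bar>s\<bar> - sqrt m)\<^sup>2 = m * (t - 1)\<^sup>2"
  proof -
    have "\<bar>s\<bar> - sqrt m = (t - 1) * sqrt m"
      using t(2) by (simp add: algebra_simps)
    then show ?thesis
      using m by (simp add: power_mult_distrib)
  qed
  moreover have "m * (t - 1)\<^sup>2 = s\<^sup>2 - m - m * (2 * (t - 1))"
    unfolding s2 by (simp add: power2_eq_square algebra_simps)
  ultimately show ?thesis
    by linarith
qed simp

lemma bregman_lower:
  assumes "\<And>i. 0 \<le> m $ i" and "\<And>i. m $ i \<noteq> 0 \<Longrightarrow> s $ i \<noteq> 0"
  shows "(\<bar>s $ i\<bar> - sqrt (m $ i))\<^sup>2 \<le> bregman m s"
proof -
  have "(\<bar>s $ i\<bar> - sqrt (m $ i))\<^sup>2 \<le> (\<Sum>i\<in>UNIV. (\<bar>s $ i\<bar> - sqrt (m $ i))\<^sup>2)"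
    by (rule member_le_sum) auto
  also have "\<dots> \<le> bregman m s"
    unfolding bregman_def using assms by (intro sum_mono bregman_term_lower) auto
  finally show ?thesis .
qed

text \<open>The multiplicative form \<open>s = x (1 + 2 \<tau> g)\<close> of the implicit Euler step makes the estimate exact:
  the only inequality used is \<open>ln (1 + y) \<le> y\<close>.\<close>

lemma bregman_term_step:
  fixes m s x g \<tau> :: real
  assumes "0 \<le> m" and "0 < 1 + 2 * \<tau> * g" and "s = x * (1 + 2 * \<tau> * g)"
    and "m \<noteq> 0 \<Longrightarrow> s \<noteq> 0"
  shows "x\<^sup>2 - m - m * (ln (x\<^sup>2) - ln m)
    \<le> (s\<^sup>2 - m - m * (ln (s\<^sup>2) - ln m)) + 4 * \<tau> * (g * (m - x\<^sup>2))"
proof -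
  define q where "q = 1 + 2 * \<tau> * g"
  have q: "0 < q" "s = x * q" "ln q \<le> 2 * \<tau> * g"
    using assms ln_le_minus_one[of q] by (auto simp: q_def)
  have "m * (ln (s\<^sup>2) - ln (x\<^sup>2)) \<le> m * (4 * \<tau> * g)"
  proof (cases "m = 0")
    case False
    then have "x \<noteq> 0"
      using assms(4) q by auto
    then have "ln (s\<^sup>2) - ln (x\<^sup>2) = 2 * ln q"
      using q(1) by (simp add: q(2) power_mult_distrib ln_mult ln_realpow)
    then show ?thesis
      using q(3) assms(1) by (intro mult_left_mono) auto
  qed simp
  moreover have "x\<^sup>2 + 4 * \<tau> * g * x\<^sup>2 \<le> s\<^sup>2"
  proof -
    have "s\<^sup>2 = x\<^sup>2 + 4 * \<tau> * g * x\<^sup>2 + (2 * \<tau> * g * x)\<^sup>2"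
      by (simp add: q(2) q_def power2_eq_square algebra_simps)
    then show ?thesis
      by simp
  qed
  ultimately show ?thesis
    unfolding right_diff_distrib by (simp add: algebra_simps)
qed

section \<open>Backward Euler sequences for convex energies\<close>

text \<open>Convexity enters through subgradients on the nonnegative orthant. The lower bound on
  their components keeps the factors \<open>1 + 2 * \<tau> * g\<close> of a step positive on a
  sublevel set once \<open>\<tau>\<close> is small.\<close>

locale convex_energy =
  fixes E :: "real^'N::finite \<Rightarrow> real" and F :: "real^'N \<Rightarrow> real" and g :: "real^'N \<Rightarrow> real^'N"
    and a :: "real^'N" and \<kappa> :: real
  assumes F_eq: "F = (\<lambda>\<sigma>. E (sq \<sigma>))"
    and rational: "pole_free_rational F"
    and a_pos: "0 < a $ i"
    and coercive: "a \<bullet> sq \<sigma> \<le> F \<sigma>"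
    and subgradient: "(\<And>i. 0 \<le> \<mu> $ i) \<Longrightarrow> (\<And>i. 0 \<le> \<nu> $ i) \<Longrightarrow> E \<mu> + g \<mu> \<bullet> (\<nu> - \<mu>) \<le> E \<nu>"
    and \<kappa>_pos: "0 < \<kappa>"
    and subgradient_lower: "(\<And>i. 0 \<le> \<mu> $ i) \<Longrightarrow> - (\<kappa> * E \<mu>) \<le> g \<mu> $ i"
begin

lemma sublevel_bounded:
  assumes "F \<sigma> \<le> c"
  shows "norm \<sigma> \<le> sqrt (\<Sum>i\<in>UNIV. c / a $ i)"
proof -
  have "(\<sigma> $ i)\<^sup>2 \<le> c / a $ i" for i
  proof -
    have "a $ i * (\<sigma> $ i)\<^sup>2 \<le> (\<Sum>i\<in>UNIV. a $ i * (\<sigma> $ i)\<^sup>2)"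
      using a_pos by (intro member_le_sum) (auto simp: less_imp_le)
    also have "\<dots> = a \<bullet> sq \<sigma>"
      by (simp add: inner_vec_def sq_def)
    also have "\<dots> \<le> c"
      using coercive assms by (rule order_trans)
    finally show ?thesis
      using a_pos[of i] by (simp add: field_simps)
  qed
  then show ?thesis
    unfolding norm_vec_def L2_set_def by (intro real_sqrt_le_mono sum_mono) simp
qed

text \<open>The subgradient inequality says that \<open>y \<mapsto> F y - g (sq x) \<bullet> sq y\<close> is minimal at \<open>x\<close>.\<close>

lemma grad_F: "grad F x $ i = 2 * x $ i * g (sq x) $ i"
proof -
  let ?g = "g (sq x)"
  let ?v = "grad F x - (\<chi> i. 2 * x $ i * ?g $ i)"
  have "((\<lambda>y. ?g \<bullet> sq y) has_derivative (\<lambda>h. (\<chi> i. 2 * x $ i * ?g $ i) \<bullet> h)) (at x)"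
    unfolding inner_vec_def sq_def
    by (auto intro!: derivative_eq_intros has_derivative_sum bounded_linear_imp_has_derivative
        bounded_linear_vec_nth simp: fun_eq_iff mult_ac intro!: sum.cong)
  from has_derivative_diff[OF pole_free_rational_grad(1)[OF rational] this]
  have der: "((\<lambda>y. F y - ?g \<bullet> sq y) has_derivative (\<lambda>h. ?v \<bullet> h)) (at x)"
    by (simp add: inner_diff_left[abs_def])
  have "F x - ?g \<bullet> sq x \<le> F y - ?g \<bullet> sq y" for y
    using subgradient[of "sq x" "sq y"] by (simp add: F_eq sq_def inner_diff_right)
  then have "(\<lambda>h. ?v \<bullet> h) = (\<lambda>h. 0)"
    by (intro differential_zero_maxmin[OF _ open_UNIV der]) auto
  then have "?v \<bullet> ?v = 0"
    by meson
  then have "?v = 0"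
    by simp
  then show ?thesis
    by (simp add: vec_eq_iff)
qed

text \<open>The sublevel set of \<open>\<sigma>0\<close> within \<open>Z\<close> is compact by
  coercivity. \<open>Z\<close> will be a coordinate subspace.\<close>

lemma exists_minimizer:
  assumes "closed Z" and "\<sigma>0 \<in> Z"
  shows "\<exists>\<sigma>\<in>Z. \<forall>\<rho>\<in>Z. F \<sigma> \<le> F \<rho>"
proof -
  let ?S = "Z \<inter> {\<sigma>. F \<sigma> \<le> F \<sigma>0}"
  have cont: "continuous_on UNIV F"
    by (rule pole_free_rational_continuous_on[OF rational])
  have "closed ?S"
    using assms(1) cont by (intro closed_Int closed_Collect_le continuous_on_const) auto
  moreover have "bounded ?S"
    using sublevel_bounded unfolding bounded_iff by blast
  ultimately have "compact ?S"
    by (simp add: compact_eq_bounded_closed)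
  then obtain \<sigma> where "\<sigma> \<in> ?S" "\<forall>\<rho>\<in>?S. F \<sigma> \<le> F \<rho>"
    using continuous_attains_inf[of ?S F] assms(2) continuous_on_subset[OF cont] by blast
  then show ?thesis
    by (intro bexI[of _ \<sigma>]) force+
qed

text \<open>Sum the one-coordinate estimate and bound the result by the subgradient inequality. The
  second claim says that zeros neither appear nor disappear, so the condition relating the zeros of
  \<open>m\<close> and \<open>s\<close> survives each step.\<close>

lemma bregman_step:
  assumes "\<And>i. 0 \<le> m $ i" and "\<And>i. m $ i \<noteq> 0 \<Longrightarrow> s $ i \<noteq> 0"
    and "0 < \<tau>" and "2 * (\<tau> * \<kappa>) * F x < 1" and "x = s - \<tau> *\<^sub>R grad F x"
  shows "bregman m x + 4 * \<tau> * (F x - E m) \<le> bregman m s"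
    and "s $ i = 0 \<longleftrightarrow> x $ i = 0"
proof -
  let ?g = "g (sq x)"
  have q: "0 < 1 + 2 * \<tau> * ?g $ i" for i
  proof -
    have "- (\<kappa> * F x) \<le> ?g $ i"
      using subgradient_lower[of "sq x"] by (simp add: F_eq sq_def)
    then have "2 * \<tau> * - (\<kappa> * F x) \<le> 2 * \<tau> * ?g $ i"
      using assms(3) by (intro mult_left_mono) auto
    then show ?thesis
      using assms(4) by (simp add: algebra_simps)
  qed
  have s: "s $ i = x $ i * (1 + 2 * \<tau> * ?g $ i)" for i
    using arg_cong[OF assms(5), of "\<lambda>v. v $ i"] by (simp add: grad_F algebra_simps)
  show "s $ i = 0 \<longleftrightarrow> x $ i = 0"
    using q[of i] by (simp add: s)
  have "bregman m x \<le> (\<Sum>i\<in>UNIV. ((s $ i)\<^sup>2 - m $ i - m $ i * (ln ((s $ i)\<^sup>2) - ln (m $ i)))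
      + 4 * \<tau> * (?g $ i * (m $ i - (x $ i)\<^sup>2)))"
    unfolding bregman_def using assms q s by (intro sum_mono bregman_term_step) auto
  also have "\<dots> = bregman m s + 4 * \<tau> * (?g \<bullet> (m - sq x))"
    by (simp add: bregman_def sum.distrib sum_distrib_left inner_vec_def sq_def)
  also have "?g \<bullet> (m - sq x) \<le> E m - F x"
    using subgradient[of "sq x" m] assms(1) by (simp add: F_eq sq_def)
  finally show "bregman m x + 4 * \<tau> * (F x - E m) \<le> bregman m s"
    using assms(3) by (simp add: algebra_simps)
qed

text \<open>A Fejer monotonicity argument in two rounds. The divergence from a fixed minimizer makes
  the energy gaps summable, so every cluster point is a minimizer. The divergence from one cluster
  point then decreases and tends to 0 along a subsequence, hence altogether.\<close>

lemma euler_sequence_converges: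
  fixes s :: "nat \<Rightarrow> real^'N"
  assumes \<tau>: "0 < \<tau>" and small: "\<And>l. 2 * (\<tau> * \<kappa>) * F (s l) < 1"
    and step: "\<And>l. s (Suc l) = s l - \<tau> *\<^sub>R grad F (s (Suc l))"
    and bound: "\<And>l. F (s l) \<le> c"
  shows "\<exists>\<mu>. (\<lambda>l. sq (s l)) \<longlonglongrightarrow> \<mu> \<and>
    is_arg_min E (\<lambda>\<nu>. \<forall>i. 0 \<le> \<nu> $ i \<and> (s 0 $ i = 0 \<longrightarrow> \<nu> $ i = 0)) \<mu>"
proof -
  define Z where "Z = {\<sigma>::real^'N. \<forall>i. s 0 $ i = 0 \<longrightarrow> \<sigma> $ i = 0}"
  have "Z = (\<Inter>i\<in>{i. s 0 $ i = 0}. {\<sigma>. \<sigma> $ i = 0})"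
    by (auto simp: Z_def)
  also have "closed \<dots>"
    by (intro closed_INT ballI closed_Collect_eq continuous_intros)
  finally have Z_closed: "closed Z" .
  have zeros: "s l $ i = 0 \<longleftrightarrow> s 0 $ i = 0" for l i
  proof (induction l)
    case (Suc l)
    then show ?case
      \<comment> \<open>With \<open>m = 0\<close> the conditions on \<open>m\<close> are
        trivial.\<close>
      using bregman_step(2)[where m = 0, OF _ _ \<tau> small step, of l i] by simp
  qed simp
  then have sZ: "s l \<in> Z" for l
    unfolding Z_def by blast
  obtain \<rho> where \<rho>: "\<rho> \<in> Z" "\<And>\<sigma>. \<sigma> \<in> Z \<Longrightarrow> F \<rho> \<le> F \<sigma>"
    using exists_minimizer[OF Z_closed sZ] by blast
  have step_le: "bregman (sq \<sigma>) (s (Suc l)) + 4 * \<tau> * (F (s (Suc l)) - F \<sigma>) \<le> bregman (sq \<sigma>) (s l)"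
    and lower: "(\<bar>s l $ i\<bar> - \<bar>\<sigma> $ i\<bar>)\<^sup>2 \<le> bregman (sq \<sigma>) (s l)"
    if "\<sigma> \<in> Z" for \<sigma> l i
  proof -
    have nz: "sq \<sigma> $ i \<noteq> 0 \<Longrightarrow> s l $ i \<noteq> 0" for i
      using that zeros by (auto simp: Z_def sq_def)
    show "bregman (sq \<sigma>) (s (Suc l)) + 4 * \<tau> * (F (s (Suc l)) - F \<sigma>) \<le> bregman (sq \<sigma>) (s l)"
      using bregman_step(1)[where m = "sq \<sigma>", OF _ nz \<tau> small step]
      by (simp add: fun_cong[OF F_eq, of \<sigma>] sq_nonneg)
    show "(\<bar>s l $ i\<bar> - \<bar>\<sigma> $ i\<bar>)\<^sup>2 \<le> bregman (sq \<sigma>) (s l)"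
      using bregman_lower[where m = "sq \<sigma>" and s = "s l" and i = i, OF _ nz] by (simp add: sq_def)
  qed
  have nonneg: "0 \<le> bregman (sq \<sigma>) (s l)" if "\<sigma> \<in> Z" for \<sigma> l
    using lower[OF that, of l] by (meson order_trans zero_le_power2)
  \<comment> \<open>The index is shifted because a step controls the gap at its end point.\<close>
  define e where "e l = F (s (Suc l)) - F \<rho>" for l
  have e_nonneg: "0 \<le> e l" for l
    using \<rho> sZ by (simp add: e_def)
  have telescope: "4 * \<tau> * (\<Sum>l<k. e l) \<le> bregman (sq \<rho>) (s 0) - bregman (sq \<rho>) (s k)" for k
  proof (induction k)
    case (Suc k)
    then show ?case
      using step_le[OF \<rho>(1), of k] by (simp add: e_def algebra_simps)
  qed simp
  have "4 * \<tau> * (\<Sum>l<k. e l) \<le> bregman (sq \<rho>) (s 0)" for k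
    using telescope[of k] nonneg[OF \<rho>(1), of k] by linarith
  then have "(\<Sum>l<k. e l) \<le> bregman (sq \<rho>) (s 0) / (4 * \<tau>)" for k
    using \<tau> by (simp add: field_simps)
  then have "summable e"
    using e_nonneg by (intro bounded_imp_summable[where B = "bregman (sq \<rho>) (s 0) / (4 * \<tau>)"])
      (metis lessThan_Suc_atMost)+
  then have "e \<longlonglongrightarrow> 0"
    by (rule summable_LIMSEQ_zero)
  then have "(\<lambda>l. F (s (Suc l))) \<longlonglongrightarrow> F \<rho>"
    unfolding e_def by (simp add: LIM_zero_iff)
  then have F_lim: "(\<lambda>l. F (s l)) \<longlonglongrightarrow> F \<rho>"
    by (rule LIMSEQ_imp_Suc)
  obtain \<sigma> r where r: "strict_mono r" and lim: "(s \<circ> r) \<longlonglongrightarrow> \<sigma>"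
  proof -
    have "s l \<in> cball 0 (sqrt (\<Sum>i\<in>UNIV. c / a $ i))" for l
      using sublevel_bounded[OF bound] by simp
    then show ?thesis
      using that compact_imp_seq_compact[OF compact_cball] unfolding seq_compact_def by metis
  qed
  have \<sigma>: "\<sigma> \<in> Z"
    using closed_sequentially[OF Z_closed _ lim] sZ by simp
  have "(\<lambda>k. F ((s \<circ> r) k)) \<longlonglongrightarrow> F \<sigma>"
    using continuous_on_tendsto_compose[OF pole_free_rational_continuous_on[OF rational, of UNIV] lim] by simp
  moreover have "(\<lambda>k. F ((s \<circ> r) k)) \<longlonglongrightarrow> F \<rho>"
    using LIMSEQ_subseq_LIMSEQ[OF F_lim r] by (simp add: o_def)
  ultimately have F\<sigma>: "F \<sigma> = F \<rho>"
    by (rule LIMSEQ_unique)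
  have dec: "decseq (\<lambda>l. bregman (sq \<sigma>) (s l))"
  proof (rule decseq_SucI)
    fix l
    have "0 \<le> 4 * \<tau> * (F (s (Suc l)) - F \<sigma>)"
      using \<tau> e_nonneg[of l] by (intro mult_nonneg_nonneg) (auto simp: e_def F\<sigma>)
    then show "bregman (sq \<sigma>) (s (Suc l)) \<le> bregman (sq \<sigma>) (s l)"
      using step_le[OF \<sigma>, of l] by linarith
  qed
  have "(\<lambda>k. bregman (sq \<sigma>) ((s \<circ> r) k)) \<longlonglongrightarrow>
      (\<Sum>i\<in>UNIV. (\<sigma> $ i)\<^sup>2 - sq \<sigma> $ i - sq \<sigma> $ i * (ln ((\<sigma> $ i)\<^sup>2) - ln (sq \<sigma> $ i)))"
    unfolding bregman_def
  proof (rule tendsto_sum)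
    fix i
    have *: "(\<lambda>k. (s \<circ> r) k $ i) \<longlonglongrightarrow> \<sigma> $ i"
      by (rule tendsto_vec_nth[OF lim])
    show "(\<lambda>k. ((s \<circ> r) k $ i)\<^sup>2 - sq \<sigma> $ i - sq \<sigma> $ i * (ln (((s \<circ> r) k $ i)\<^sup>2) - ln (sq \<sigma> $ i)))
        \<longlonglongrightarrow> (\<sigma> $ i)\<^sup>2 - sq \<sigma> $ i - sq \<sigma> $ i * (ln ((\<sigma> $ i)\<^sup>2) - ln (sq \<sigma> $ i))"
    \<comment> \<open>The logarithm is discontinuous at 0, but there its coefficient
      \<open>sq \<sigma> $ i\<close> vanishes.\<close>
    proof (cases "\<sigma> $ i = 0")
      case True
      then show ?thesis
        using tendsto_power[OF *, of 2] by (simp add: sq_def)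
    next
      case False
      then show ?thesis
        by (intro tendsto_diff tendsto_mult tendsto_power tendsto_ln tendsto_const *) auto
    qed
  qed
  then have sub: "(\<lambda>k. bregman (sq \<sigma>) (s (r k))) \<longlonglongrightarrow> 0"
    by (simp add: sq_def)
  have breg: "(\<lambda>l. bregman (sq \<sigma>) (s l)) \<longlonglongrightarrow> 0"
  proof -
    obtain b where b: "(\<lambda>l. bregman (sq \<sigma>) (s l)) \<longlonglongrightarrow> b"
      using decseq_convergent[OF dec] nonneg[OF \<sigma>] by metis
    from LIMSEQ_subseq_LIMSEQ[OF this r] sub have "b = 0"
      by (auto simp: o_def intro: LIMSEQ_unique)
    with b show ?thesis
      by simp
  qed
  have "(\<lambda>l. (\<bar>s l $ i\<bar> - \<bar>\<sigma> $ i\<bar>)\<^sup>2) \<longlonglongrightarrow> 0" for i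
    by (rule Lim_null_comparison[OF always_eventually breg]) (use lower[OF \<sigma>] in simp)
  then have "(\<lambda>l. \<bar>s l $ i\<bar>) \<longlonglongrightarrow> \<bar>\<sigma> $ i\<bar>" for i
    by (simp only: power_tendsto_0_iff zero_less_numeral LIM_zero_iff)
  then have "(\<lambda>l. \<bar>s l $ i\<bar>\<^sup>2) \<longlonglongrightarrow> \<bar>\<sigma> $ i\<bar>\<^sup>2" for i
    by (rule tendsto_power)
  then have "(\<lambda>l. sq (s l)) \<longlonglongrightarrow> sq \<sigma>"
    by (intro vec_tendstoI) (simp add: sq_def)
  moreover have "is_arg_min E (\<lambda>\<nu>. \<forall>i. 0 \<le> \<nu> $ i \<and> (s 0 $ i = 0 \<longrightarrow> \<nu> $ i = 0)) (sq \<sigma>)"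
  proof -
    have "E (sq \<sigma>) \<le> E \<nu>" if \<nu>: "\<forall>i. 0 \<le> \<nu> $ i \<and> (s 0 $ i = 0 \<longrightarrow> \<nu> $ i = 0)" for \<nu>
    proof -
      \<comment> \<open>Every competitor is the square of a vector in \<open>Z\<close>, so
        minimality of \<open>F\<close> on \<open>Z\<close> transfers to \<open>E\<close>.\<close>
      have "sq (\<chi> i. sqrt (\<nu> $ i)) = \<nu>"
        using \<nu> by (simp add: sq_def vec_eq_iff)
      moreover have "(\<chi> i. sqrt (\<nu> $ i)) \<in> Z"
        using \<nu> by (simp add: Z_def)
      ultimately show ?thesis
        using \<rho>(2) F\<sigma> by (metis F_eq)
    qed
    then show ?thesis
      using \<sigma> by (auto simp: is_arg_min_linorder sq_def Z_def)
  qed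
  ultimately show ?thesis
    by blast
qed

section \<open>Choice of the thresholds\<close>

lemma backward_euler_newton:
  "\<exists>\<tau>s>0. euler_newton_consistent E c \<tau>s \<and>
    (\<forall>\<tau>. 0 < \<tau> \<and> \<tau> < \<tau>s \<longrightarrow>
      (\<exists>\<epsilon>s>0. \<forall>\<epsilon>. 0 < \<epsilon> \<and> \<epsilon> \<le> \<epsilon>s \<longrightarrow>
        (\<forall>\<sigma>. F \<sigma> < c \<longrightarrow>
          newton_converges F \<tau> \<sigma> \<and>
          (newton_stops F \<epsilon> \<tau> \<sigma> \<longrightarrow>
            F \<sigma> - F (inexact_step F \<epsilon> \<tau> \<sigma>) \<ge> (F \<sigma> - F (exact_step F \<tau> \<sigma>)) / 2))))"
proof -
  \<comment> \<open>This radius contains the whole sublevel set, so one constant \<open>M\<close>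
    works for every starting point in it.\<close>
  define R where "R = sqrt (\<Sum>i\<in>UNIV. c / a $ i)"
  obtain M where "0 < M" "\<forall>x\<in>cball 0 (R + 1). \<forall>y\<in>cball 0 (R + 1). \<forall>v.
      norm (grad F x) \<le> M \<and> norm (grad F x - grad F y) \<le> M * norm (x - y) \<and>
      norm (hess F x *v v) \<le> M * norm v \<and>
      norm ((hess F x - hess F y) *v v) \<le> M * norm (x - y) * norm v"
    using pole_free_rational_bounds[OF rational] by blast
  then interpret newton_bounds F R M
    by unfold_locales (use rational in blast)+
  \<comment> \<open>The first bound serves the Newton contraction, the second the positivity of the
    multiplicative factors; \<open>\<bar>c\<bar> + 1\<close> is a positive upper bound for
    \<open>F\<close> on the sublevel set.\<close>
  define \<tau>s where "\<tau>s = min (1 / (16 * M)) (1 / (2 * \<kappa> * (\<bar>c\<bar> + 1)))"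
  have \<tau>s: "0 < \<tau>s"
    using M_pos \<kappa>_pos by (simp add: \<tau>s_def add_nonneg_pos)
  have sublevel: "\<sigma> \<in> cball 0 R" if "F \<sigma> < c" for \<sigma>
    using sublevel_bounded[of \<sigma> c] that by (simp add: R_def)
  have M: "16 * (\<tau> * M) \<le> 1" and \<kappa>: "F \<sigma> < c \<Longrightarrow> 2 * (\<tau> * \<kappa>) * F \<sigma> < 1"
    if "0 < \<tau>" "\<tau> < \<tau>s" for \<tau> \<sigma>
  proof -
    show "16 * (\<tau> * M) \<le> 1"
      using that M_pos by (simp add: \<tau>s_def field_simps)
    have "2 * (\<tau> * \<kappa>) * F \<sigma> \<le> 2 * (\<tau> * \<kappa>) * (\<bar>c\<bar> + 1)" if "F \<sigma> < c"
      using that \<open>0 < \<tau>\<close> \<kappa>_pos by (intro mult_left_mono) auto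
    also have "2 * (\<tau> * \<kappa>) * (\<bar>c\<bar> + 1) < 1"
    proof -
      have "0 < 2 * \<kappa> * (\<bar>c\<bar> + 1)"
        using \<kappa>_pos by (intro mult_pos_pos) auto
      moreover have "\<tau> < 1 / (2 * \<kappa> * (\<bar>c\<bar> + 1))"
        using that by (simp add: \<tau>s_def)
      ultimately have "\<tau> * (2 * \<kappa> * (\<bar>c\<bar> + 1)) < 1"
        by (simp only: pos_less_divide_eq)
      then show ?thesis
        by (simp only: mult_ac)
    qed
    finally show "2 * (\<tau> * \<kappa>) * F \<sigma> < 1" if "F \<sigma> < c"
      using that by blast
  qed
  have "euler_newton_consistent E c \<tau>s"
    unfolding euler_newton_consistent_def Let_def F_eq[symmetric]
  proof (intro allI impI, elim conjE)
    fix \<sigma>0 \<tau>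
    assume \<sigma>0: "F \<sigma>0 < c" and \<tau>: "0 < \<tau>" "\<tau> < \<tau>s"
    define s where "s l = (exact_step F \<tau> ^^ l) \<sigma>0" for l
    have s_Suc: "s (Suc l) = exact_step F \<tau> (s l)" for l
      by (simp add: s_def)
    \<comment> \<open>Exact steps decrease \<open>F\<close>, so the sequence never leaves the region
      where the bounds hold.\<close>
    have Fs: "F (s l) < c" for l
    proof (induction l)
      case (Suc l)
      have "0 \<le> (norm (exact_step F \<tau> (s l) - s l))\<^sup>2 / (2 * \<tau>)"
        using \<tau> by simp
      with exact_step_descent[OF \<tau>(1) M[OF \<tau>] sublevel[OF Suc]] Suc show ?case
        by (simp add: s_Suc)
    qed (simp add: s_def \<sigma>0)
    have step: "s (Suc l) = s l - \<tau> *\<^sub>R grad F (s (Suc l))" for l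
      unfolding s_Suc by (rule newton_converges_and_limit(3)[OF \<tau>(1) M[OF \<tau>] sublevel[OF Fs]])
    have "newton_converges F \<tau> (s l)" for l
      by (rule newton_converges_and_limit(1)[OF \<tau>(1) M[OF \<tau>] sublevel[OF Fs]])
    moreover have "grad F (s (Suc l)) = - ((s (Suc l) - s l) /\<^sub>R \<tau>)" for l
    proof -
      have "v = - ((y - z) /\<^sub>R \<tau>)" if "y = z - \<tau> *\<^sub>R v" for y z v :: "real^'N"
        using that \<tau> by simp
      from this[OF step] show ?thesis .
    qed
    moreover have "\<exists>\<mu>. (\<lambda>l. sq (s l)) \<longlonglongrightarrow> \<mu> \<and>
        is_arg_min E (\<lambda>\<nu>. \<forall>i. 0 \<le> \<nu> $ i \<and> (s 0 $ i = 0 \<longrightarrow> \<nu> $ i = 0)) \<mu>"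
      using \<kappa>[OF \<tau> Fs] less_imp_le[OF Fs] by (intro euler_sequence_converges[where s = s, OF \<tau>(1) _ step]) auto
    ultimately show "(\<forall>l. newton_converges F \<tau> ((exact_step F \<tau> ^^ l) \<sigma>0) \<and>
        grad F ((exact_step F \<tau> ^^ Suc l) \<sigma>0)
          = - (((exact_step F \<tau> ^^ Suc l) \<sigma>0 - (exact_step F \<tau> ^^ l) \<sigma>0) /\<^sub>R \<tau>)) \<and>
      (\<exists>\<mu>. (\<lambda>l. sq ((exact_step F \<tau> ^^ l) \<sigma>0)) \<longlonglongrightarrow> \<mu> \<and>
        is_arg_min E (\<lambda>\<nu>. \<forall>i. 0 \<le> \<nu> $ i \<and> (\<sigma>0 $ i = 0 \<longrightarrow> \<nu> $ i = 0)) \<mu>)"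
      unfolding s_def by simp
  qed
  \<comment> \<open>The threshold \<open>1 / (12 * \<tau>)\<close> is the smallness condition of
    \<open>inexact_step_descent\<close>.\<close>
  moreover have "newton_converges F \<tau> \<sigma> \<and> (newton_stops F \<epsilon> \<tau> \<sigma> \<longrightarrow>
      F \<sigma> - F (inexact_step F \<epsilon> \<tau> \<sigma>) \<ge> (F \<sigma> - F (exact_step F \<tau> \<sigma>)) / 2)"
    if \<tau>: "0 < \<tau>" "\<tau> < \<tau>s" and \<epsilon>: "0 < \<epsilon>" "\<epsilon> \<le> 1 / (12 * \<tau>)" and \<sigma>: "F \<sigma> < c" for \<tau> \<epsilon> \<sigma>
    using newton_converges_and_limit(1)[OF \<tau>(1) M[OF \<tau>] sublevel[OF \<sigma>]]
      inexact_step_descent[OF \<tau>(1) M[OF \<tau>] sublevel[OF \<sigma>] \<epsilon>(1)] \<epsilon> \<tau>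
    by (auto simp: field_simps)
  moreover have "0 < 1 / (12 * \<tau>)" if "0 < \<tau>" for \<tau> :: real
    using that by simp
  ultimately show ?thesis
    using \<tau>s by blast
qed

end

section \<open>The discrete energy\<close>

text \<open>Abstracts the mesh to symmetric positive semidefinite matrices; the last assumption says
  that their quadratic forms have no common nonzero null vector.\<close>

locale discrete_energy =
  fixes K :: "'N::finite \<Rightarrow> real^'m::finite^'m" and \<delta> :: real and b :: "real^'m" and a :: "real^'N"
  assumes \<delta>_pos: "0 < \<delta>"
    and a_pos: "0 < a $ i"
    and K_sym: "v \<bullet> (K i *v w) = w \<bullet> (K i *v v)"
    and K_nonneg: "0 \<le> v \<bullet> (K i *v v)"
    and K_definite: "(\<And>i. v \<bullet> (K i *v v) = 0) \<Longrightarrow> v = 0"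
begin

definition A :: "real^'N \<Rightarrow> real^'m^'m" where
  "A \<mu> = (\<Sum>i\<in>UNIV. (\<mu> $ i + \<delta>) *\<^sub>R K i)"

definition u :: "real^'N \<Rightarrow> real^'m" where
  "u \<mu> = matrix_inv (A \<mu>) *v b"

definition J :: "real^'N \<Rightarrow> real" where
  "J \<mu> = b \<bullet> u \<mu> + \<mu> \<bullet> a"

lemma A_form: "v \<bullet> (A \<mu> *v w) = (\<Sum>i\<in>UNIV. (\<mu> $ i + \<delta>) * (v \<bullet> (K i *v w)))"
proof -
  have "A \<mu> *v w = (\<Sum>i\<in>UNIV. (\<mu> $ i + \<delta>) *\<^sub>R (K i *v w))"
    unfolding A_def by (induction rule: infinite_finite_induct[of _ UNIV])
      (simp_all add: matrix_vector_mult_add_rdistrib scaleR_matrix_vector_assoc)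
  then show ?thesis
    by (simp add: inner_sum_right)
qed

text \<open>All weights are at least \<open>\<delta> > 0\<close>, so each local energy of a kernel
  vector vanishes.\<close>

lemma A_invertible:
  assumes "\<And>i. 0 \<le> \<mu> $ i"
  shows "invertible (A \<mu>)"
proof -
  have "v = 0" if "A \<mu> *v v = 0" for v
  proof (rule K_definite)
    fix i
    have "(\<Sum>i\<in>UNIV. (\<mu> $ i + \<delta>) * (v \<bullet> (K i *v v))) = 0"
      using A_form[of v \<mu> v] that by simp
    then have "(\<mu> $ i + \<delta>) * (v \<bullet> (K i *v v)) = 0"
      using assms \<delta>_pos K_nonneg by (subst (asm) sum_nonneg_eq_0_iff) (auto intro!: mult_nonneg_nonneg add_nonneg_nonneg)
    then show "v \<bullet> (K i *v v) = 0"
      using assms[of i] \<delta>_pos by simp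
  qed
  then show ?thesis
    by (auto simp: invertible_left_inverse matrix_left_invertible_ker)
qed

lemma A_u: "(\<And>i. 0 \<le> \<mu> $ i) \<Longrightarrow> A \<mu> *v u \<mu> = b"
  by (simp add: u_def matrix_vector_mul_assoc matrix_inv_right[OF A_invertible])

lemma b_u: "(\<And>i. 0 \<le> \<mu> $ i) \<Longrightarrow> b \<bullet> u \<mu> = (\<Sum>i\<in>UNIV. (\<mu> $ i + \<delta>) * (u \<mu> \<bullet> (K i *v u \<mu>)))"
  by (metis A_form A_u inner_commute)

text \<open>Completing the square: \<open>u \<mu>\<close> maximizes the left side, with value
  \<open>b \<bullet> u \<mu>\<close>. For fixed \<open>v\<close> the left side is affine in
  \<open>\<mu>\<close>, which is the source of the convexity of \<open>J\<close>.\<close>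

lemma dual_bound:
  assumes "\<And>i. 0 \<le> \<mu> $ i"
  shows "2 * (b \<bullet> v) - v \<bullet> (A \<mu> *v v) \<le> b \<bullet> u \<mu>"
proof -
  have "0 \<le> (v - u \<mu>) \<bullet> (A \<mu> *v (v - u \<mu>))"
    unfolding A_form using assms \<delta>_pos K_nonneg
    by (intro sum_nonneg mult_nonneg_nonneg add_nonneg_nonneg) auto
  also have "\<dots> = v \<bullet> (A \<mu> *v v) - v \<bullet> (A \<mu> *v u \<mu>) - u \<mu> \<bullet> (A \<mu> *v v) + u \<mu> \<bullet> (A \<mu> *v u \<mu>)"
    by (simp add: matrix_vector_mult_diff_distrib inner_diff_left inner_diff_right)
  also have "u \<mu> \<bullet> (A \<mu> *v v) = v \<bullet> (A \<mu> *v u \<mu>)"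
    unfolding A_form by (subst K_sym) simp
  finally show ?thesis
    by (simp add: A_u assms inner_commute[of _ b])
qed

text \<open>Cramer's rule writes the solution as a quotient of determinants. The squares keep the
  weights positive for every real \<open>\<sigma>\<close>, so the denominator never
  vanishes.\<close>

lemma J_rational: "pole_free_rational (\<lambda>\<sigma>. J (sq \<sigma>))"
proof -
  have entry: "pole_free_rational (\<lambda>\<sigma>. A (sq \<sigma>) $ p $ q)" for p q
    unfolding A_def sq_def sum_component vector_scaleR_component vec_lambda_beta real_scaleR_def
    by (intro pole_free_rational_sum pole_free_rational.intros pole_free_rational_power)
  have det: "det (A (sq \<sigma>)) \<noteq> 0" for \<sigma>
    using A_invertible[of "sq \<sigma>"] by (simp add: sq_nonneg invertible_det_nz)
  have u_eq: "u (sq \<sigma>) = (\<chi> k. det (\<chi> i j. if j = k then b $ i else A (sq \<sigma>) $ i $ j) / det (A (sq \<sigma>)))" for \<sigma>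
    using cramer[OF det, of _ "u (sq \<sigma>)" b] A_u[of "sq \<sigma>"] by (simp add: sq_nonneg)
  have u: "u (sq \<sigma>) $ k
      = det (\<chi> i j. if j = k then b $ i else A (sq \<sigma>) $ i $ j) / det (A (sq \<sigma>))" for \<sigma> k
    by (simp only: u_eq vec_lambda_beta)
  have "pole_free_rational (\<lambda>\<sigma>. if j = k then b $ i else A (sq \<sigma>) $ i $ j)" for i j k
    by (cases "j = k") (simp_all add: entry pole_free_rational.const)
  then have "pole_free_rational (\<lambda>\<sigma>. u (sq \<sigma>) $ k)" for k
    unfolding u using det entry
    by (intro pole_free_rational_divide pole_free_rational_det) simp_all
  then have "pole_free_rational (\<lambda>\<sigma>. b \<bullet> u (sq \<sigma>))"
    unfolding inner_vec_def inner_real_def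
    by (intro pole_free_rational_sum pole_free_rational_cmult)
  moreover have "pole_free_rational (\<lambda>\<sigma>. sq \<sigma> \<bullet> a)"
    unfolding inner_vec_def inner_real_def sq_def vec_lambda_beta
    by (intro pole_free_rational_sum pole_free_rational.intros pole_free_rational_power)
  ultimately show ?thesis
    unfolding J_def by (rule pole_free_rational.add)
qed

text \<open>The subgradient inequality is \<open>dual_bound\<close> at \<open>\<nu>\<close> tested
  with the solution \<open>u \<mu>\<close> for \<open>\<mu>\<close>. The constant
  \<open>1 / \<delta>\<close> arises since \<open>\<delta>\<close> times any local energy is at most
  \<open>J \<mu>\<close>.\<close>

lemma J_convex_energy:
  "convex_energy J (\<lambda>\<sigma>. J (sq \<sigma>)) (\<lambda>\<mu>. \<chi> i. a $ i - u \<mu> \<bullet> (K i *v u \<mu>)) a (1 / \<delta>)"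
proof
  show "0 < a $ i" "0 < 1 / \<delta>" for i
    using a_pos \<delta>_pos by auto
  show "pole_free_rational (\<lambda>\<sigma>. J (sq \<sigma>))"
    by (rule J_rational)
  have term_nonneg: "0 \<le> (\<mu> $ i + \<delta>) * (u \<mu> \<bullet> (K i *v u \<mu>))" if "\<And>i. 0 \<le> \<mu> $ i" for \<mu> i
    using that \<delta>_pos K_nonneg by (intro mult_nonneg_nonneg add_nonneg_nonneg) auto
  show "a \<bullet> sq \<sigma> \<le> J (sq \<sigma>)" for \<sigma>
    using term_nonneg[of "sq \<sigma>"]
    by (simp add: J_def inner_commute b_u sq_nonneg sum_nonneg)
  show "J \<mu> + (\<chi> i. a $ i - u \<mu> \<bullet> (K i *v u \<mu>)) \<bullet> (\<nu> - \<mu>) \<le> J \<nu>"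
    if \<mu>: "\<And>i. 0 \<le> \<mu> $ i" and \<nu>: "\<And>i. 0 \<le> \<nu> $ i" for \<mu> \<nu>
  proof -
    let ?q = "\<lambda>i. u \<mu> \<bullet> (K i *v u \<mu>)"
    have "(\<chi> i. a $ i - ?q i) \<bullet> (\<nu> - \<mu>) = (\<Sum>i\<in>UNIV. (\<nu> $ i * a $ i - \<mu> $ i * a $ i)
        + ((\<mu> $ i + \<delta>) * ?q i - (\<nu> $ i + \<delta>) * ?q i))"
      unfolding inner_vec_def by (intro sum.cong) (auto simp: algebra_simps)
    also have "\<dots> = \<nu> \<bullet> a - \<mu> \<bullet> a + (b \<bullet> u \<mu> - u \<mu> \<bullet> (A \<nu> *v u \<mu>))"
      by (simp add: sum.distrib sum_subtractf A_form b_u[OF \<mu>] inner_vec_def[of \<mu>] inner_vec_def[of \<nu>])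
    finally show ?thesis
      using dual_bound[OF \<nu>, of "u \<mu>"] by (simp add: J_def)
  qed
  show "- (1 / \<delta> * J \<mu>) \<le> (\<chi> i. a $ i - u \<mu> \<bullet> (K i *v u \<mu>)) $ i" if \<mu>: "\<And>i. 0 \<le> \<mu> $ i" for \<mu> i
  proof -
    have "\<delta> * (u \<mu> \<bullet> (K i *v u \<mu>)) \<le> (\<mu> $ i + \<delta>) * (u \<mu> \<bullet> (K i *v u \<mu>))"
      using \<mu> K_nonneg by (intro mult_right_mono) auto
    also have "\<dots> \<le> (\<Sum>i\<in>UNIV. (\<mu> $ i + \<delta>) * (u \<mu> \<bullet> (K i *v u \<mu>)))"
      using term_nonneg[OF \<mu>] by (intro member_le_sum) auto
    also have "\<dots> \<le> J \<mu>"
      unfolding J_def b_u[OF \<mu>, symmetric] inner_vec_def[of \<mu>]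
      using \<mu> a_pos by (simp add: sum_nonneg less_imp_le)
    finally have "u \<mu> \<bullet> (K i *v u \<mu>) \<le> J \<mu> / \<delta>"
      using \<delta>_pos by (simp add: field_simps)
    then show ?thesis
      using a_pos[of i] by simp
  qed
qed simp

end

section \<open>Piecewise affine functions on the cube\<close>

lemma closure_unit_cube: "closure (unit_cube :: (real^'d::finite) set) = cbox 0 1"
  and interior_closure_unit_cube: "interior (closure (unit_cube :: (real^'d) set)) = unit_cube"
proof -
  have "unit_cube \<noteq> ({} :: (real^'d) set)"
    unfolding unit_cube_def by (simp add: interval_ne_empty_cart)
  then show "closure (unit_cube :: (real^'d) set) = cbox 0 1"
    unfolding unit_cube_def by (rule closure_box)
  then show "interior (closure (unit_cube :: (real^'d) set)) = unit_cube"
    by (simp add: unit_cube_def interior_cbox)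
qed

lemma unit_cube_measurable: "unit_cube \<in> lmeasurable" "open unit_cube" "bounded unit_cube"
  by (simp_all add: unit_cube_def bounded_box open_box)

lemma simplicial_triangulation_of_cubeD:
  fixes \<T> :: "(real^'d::finite) set set"
  assumes "simplicial_triangulation_of_cube \<T>"
  shows "finite \<T>"
    and "S \<in> \<T> \<Longrightarrow> convex S" and "S \<in> \<T> \<Longrightarrow> compact S"
    and "S \<in> \<T> \<Longrightarrow> interior S \<noteq> {}" and "S \<in> \<T> \<Longrightarrow> interior S \<subseteq> unit_cube"
    and "\<Union>\<T> = closure unit_cube"
proof -
  show "finite \<T>" and *: "\<Union>\<T> = closure unit_cube"
    using assms by (auto simp: simplicial_triangulation_of_cube_def triangulation_def)
  show "convex S" and "compact S" and "interior S \<noteq> {}" if "S \<in> \<T>"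
  proof -
    have S: "int CARD('d) simplex S"
      using assms that by (auto simp: simplicial_triangulation_of_cube_def)
    show "convex S" "compact S"
      using S by (auto intro: convex_simplex compact_simplex)
    have "aff_dim S = int (DIM(real^'d))"
      using S by (simp add: aff_dim_simplex)
    moreover from this have "S \<noteq> {}"
      by auto
    ultimately show "interior S \<noteq> {}"
      using \<open>convex S\<close> by (simp add: interior_rel_interior_gen rel_interior_eq_empty)
  qed
  show "interior S \<subseteq> unit_cube" if "S \<in> \<T>"
    using interior_mono[of S "closure unit_cube"] that * interior_closure_unit_cube by blast
qed

locale fine_mesh =
  fixes \<S> :: "(real^'d::finite) set set"
  assumes triangulation: "simplicial_triangulation_of_cube \<S>"
begin

lemmas mesh = simplicial_triangulation_of_cubeD[OF triangulation]

definition interiors :: "(real^'d) set" where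
  "interiors = (\<Union>S\<in>\<S>. interior S)"

text \<open>Finitely many frontiers of convex sets cover it. Hence the values of \<open>grad\<close>
  on simplex boundaries do not affect integrals.\<close>

lemma negligible_skeleton: "negligible (closure unit_cube - interiors)"
proof (rule negligible_subset)
  show "negligible (\<Union>S\<in>\<S>. frontier S)"
    using mesh by (intro negligible_Union) (auto intro: negligible_convex_frontier)
  show "closure unit_cube - interiors \<subseteq> (\<Union>S\<in>\<S>. frontier S)"
  proof
    fix x
    assume x: "x \<in> closure unit_cube - interiors"
    then obtain S where "S \<in> \<S>" "x \<in> S"
      using mesh(6) by blast
    moreover from this x have "x \<in> frontier S"
      using closure_subset[of S] by (auto simp: interiors_def frontier_def)
    ultimately show "x \<in> (\<Union>S\<in>\<S>. frontier S)"
      by blast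
  qed
qed

lemma affine_pieces:
  assumes "w \<in> pw_affine_space \<S>"
  obtains g b where "\<And>S x. S \<in> \<S> \<Longrightarrow> x \<in> S \<inter> unit_cube \<Longrightarrow> w x = g S \<bullet> x + b S"
    and "\<And>S x. S \<in> \<S> \<Longrightarrow> x \<in> interior S \<Longrightarrow> grad w x = g S"
proof -
  have "\<forall>S\<in>\<S>. \<exists>g b. \<forall>x\<in>S \<inter> unit_cube. w x = g \<bullet> x + b"
    using assms by (simp add: pw_affine_space_def)
  then obtain g b where w: "\<And>S x. S \<in> \<S> \<Longrightarrow> x \<in> S \<inter> unit_cube \<Longrightarrow> w x = g S \<bullet> x + b S"
    by metis
  moreover have "grad w x = g S" if S: "S \<in> \<S>" and x: "x \<in> interior S" for S x
  proof (rule grad_eqI)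
    have "((\<lambda>x. g S \<bullet> x + b S) has_derivative (\<bullet>) (g S)) (at x)"
      by (auto intro!: derivative_eq_intros)
    then show "(w has_derivative (\<bullet>) (g S)) (at x)"
    proof (rule has_derivative_transform_within_open[OF _ open_interior x])
      show "g S \<bullet> y + b S = w y" if "y \<in> interior S" for y
        using w[OF S] mesh(5)[OF S] that interior_subset by fastforce
    qed
  qed
  ultimately show thesis
    by (rule that)
qed

text \<open>Finitely many affine pieces are bounded on the bounded cube. Integrability is what later
  allows the integral to pass through linear combinations.\<close>

lemma integrable_on_cube:
  assumes "w \<in> pw_affine_space \<S>"
  shows "set_integrable lebesgue unit_cube w"
proof -
  obtain g b where w: "\<And>S x. S \<in> \<S> \<Longrightarrow> x \<in> S \<inter> unit_cube \<Longrightarrow> w x = g S \<bullet> x + b S"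
    using affine_pieces[OF assms] by metis
  obtain B where B: "0 \<le> B" "\<And>x. x \<in> unit_cube \<Longrightarrow> norm (x::real^'d) \<le> B"
    using unit_cube_measurable(3) by (meson bounded_pos less_imp_le)
  let ?C = "\<Sum>S\<in>\<S>. norm (g S) * B + \<bar>b S\<bar>"
  show ?thesis
  proof (rule measurable_bounded_by_integrable_imp_absolutely_integrable)
    show "w \<in> borel_measurable (lebesgue_on unit_cube)"
      using assms unit_cube_measurable(1)
      by (intro continuous_imp_measurable_on_sets_lebesgue) (auto simp: pw_affine_space_def)
    show "(\<lambda>x. ?C) integrable_on (unit_cube :: (real^'d) set)"
      using unit_cube_measurable(1) by (rule integrable_on_const)
    show "norm (w x) \<le> ?C" if x: "x \<in> unit_cube" for x
    proof -
      obtain S where S: "S \<in> \<S>" "x \<in> S"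
        using mesh(6) x closure_subset by blast
      have "norm (w x) \<le> \<bar>g S \<bullet> x\<bar> + \<bar>b S\<bar>"
        using w[OF S(1)] S x by simp
      also have "\<dots> \<le> norm (g S) * B + \<bar>b S\<bar>"
        using Cauchy_Schwarz_ineq2[of "g S" x] B(2)[OF x]
        by (intro add_right_mono) (meson mult_left_mono norm_ge_zero order_trans)
      also have "\<dots> \<le> ?C"
        using S(1) mesh(1) B(1) by (intro member_le_sum) auto
      finally show ?thesis .
    qed
  qed (use unit_cube_measurable(1) in auto)
qed

text \<open>The integrand is constant on each open simplex, hence continuous and bounded on their
  union; the null skeleton is added afterwards.\<close>

lemma integrable_grad_inner:
  assumes "w \<in> pw_affine_space \<S>" and "w' \<in> pw_affine_space \<S>"
    and "X \<in> sets lebesgue" and "X \<subseteq> closure unit_cube"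
  shows "set_integrable lebesgue X (\<lambda>x. grad w x \<bullet> grad w' x)"
proof -
  obtain g where g: "\<And>S x. S \<in> \<S> \<Longrightarrow> x \<in> interior S \<Longrightarrow> grad w x = g S"
    using affine_pieces[OF assms(1)] by metis
  obtain g' where g': "\<And>S x. S \<in> \<S> \<Longrightarrow> x \<in> interior S \<Longrightarrow> grad w' x = g' S"
    using affine_pieces[OF assms(2)] by metis
  let ?h = "\<lambda>x. grad w x \<bullet> grad w' x" and ?C = "\<Sum>S\<in>\<S>. \<bar>g S \<bullet> g' S\<bar>"
  have "interiors \<subseteq> unit_cube"
    using mesh(5) by (auto simp: interiors_def)
  then have meas: "interiors \<in> lmeasurable"
    using unit_cube_measurable(3)
    by (intro lmeasurable_open) (auto simp: interiors_def intro: bounded_subset)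
  have "continuous_on interiors ?h"
    unfolding interiors_def
  proof (rule continuous_on_open_UN)
    show "continuous_on (interior S) ?h" if "S \<in> \<S>" for S
      using that by (subst continuous_on_cong[OF refl, where g = "\<lambda>x. g S \<bullet> g' S"]) (auto simp: g g')
  qed auto
  then have "?h absolutely_integrable_on interiors"
    using meas
  proof (intro measurable_bounded_by_integrable_imp_absolutely_integrable)
    show "norm (?h x) \<le> ?C" if x: "x \<in> interiors" for x
    proof -
      obtain S where S: "S \<in> \<S>" "x \<in> interior S"
        using x by (auto simp: interiors_def)
      have "\<bar>g S \<bullet> g' S\<bar> \<le> ?C"
        using S(1) mesh(1) by (intro member_le_sum) auto
      then show ?thesis
        using S by (simp add: g g')
    qed
    show "(\<lambda>x. ?C) integrable_on interiors"
      using meas by (rule integrable_on_const)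
  qed (auto intro: continuous_imp_measurable_on_sets_lebesgue)
  then have "?h absolutely_integrable_on closure unit_cube"
  proof (rule absolutely_integrable_spike_set)
    have "{x \<in> interiors - closure unit_cube. ?h x \<noteq> 0} = {}"
      using \<open>interiors \<subseteq> unit_cube\<close> closure_subset by blast
    then show "negligible {x \<in> interiors - closure unit_cube. ?h x \<noteq> 0}"
      by (simp only: negligible_empty)
    show "negligible {x \<in> closure unit_cube - interiors. ?h x \<noteq> 0}"
      using negligible_skeleton by (rule negligible_subset) auto
  qed
  then show ?thesis
    using assms(3,4) by (rule set_integrable_subset)
qed

text \<open>Identifies the quadratic form of the stiffness matrix with the Dirichlet energy on
  \<open>X\<close>.\<close>

lemma local_stiffness_form:
  fixes \<phi> :: "'m::finite \<Rightarrow> real^'d \<Rightarrow> real"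
  assumes "\<And>p. \<phi> p \<in> pw_affine_space \<S>" and "X \<in> sets lebesgue" and "X \<subseteq> closure unit_cube"
  defines "e \<equiv> \<lambda>v x. (norm (\<Sum>p\<in>UNIV. v $ p *\<^sub>R grad (\<phi> p) x))\<^sup>2"
  shows "set_integrable lebesgue X (e v)"
    and "v \<bullet> (local_stiffness X \<phi> *v v) = (LINT x:X|lebesgue. e v x)"
proof -
  have e: "e v x = (\<Sum>p\<in>UNIV. \<Sum>q\<in>UNIV. v $ p * (v $ q * (grad (\<phi> p) x \<bullet> grad (\<phi> q) x)))" for x
    unfolding e_def power2_norm_eq_inner inner_sum_left inner_sum_right
    by (intro sum.cong refl) (simp add: inner_commute)
  have int: "integrable lebesgue (\<lambda>x. indicator X x * (grad (\<phi> p) x \<bullet> grad (\<phi> q) x))" for p q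
    using integrable_grad_inner[OF assms(1) assms(1) assms(2,3)] by (simp add: set_integrable_def)
  have ind: "indicator X x * e v x = (\<Sum>p\<in>UNIV. \<Sum>q\<in>UNIV. v $ p * (v $ q *
      (indicator X x * (grad (\<phi> p) x \<bullet> grad (\<phi> q) x))))" for x
    by (simp add: e sum_distrib_left mult_ac)
  show "set_integrable lebesgue X (e v)"
    unfolding set_integrable_def real_scaleR_def ind
    by (intro Bochner_Integration.integrable_sum integrable_mult_right int)
  show "v \<bullet> (local_stiffness X \<phi> *v v) = (LINT x:X|lebesgue. e v x)"
    unfolding set_lebesgue_integral_def real_scaleR_def ind
    by (simp add: Bochner_Integration.integral_sum int local_stiffness_def inner_vec_def[of v]
        matrix_vector_mult_def set_lebesgue_integral_def sum_distrib_left mult_ac)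
qed

text \<open>The combination is constant on each simplex, so its image of the connected cube is
  finite and connected, hence a single value. Zero mean makes this value 0, and uniqueness of
  coefficients in the basis gives \<open>v = 0\<close>.\<close>

lemma gradient_free_imp_zero:
  fixes \<phi> :: "'m::finite \<Rightarrow> real^'d \<Rightarrow> real"
  assumes basis: "basis_on_cube \<phi> (pw_affine_space \<S>)"
    and null: "negligible {x \<in> closure unit_cube. (\<Sum>p\<in>UNIV. v $ p *\<^sub>R grad (\<phi> p) x) \<noteq> 0}"
  shows "v = 0"
proof -
  have \<phi>: "\<phi> p \<in> pw_affine_space \<S>" for p
    using basis by (simp add: basis_on_cube_def)
  let ?w = "\<lambda>x. \<Sum>p\<in>UNIV. v $ p * \<phi> p x"
  have pieces: "\<exists>k. \<forall>x\<in>S \<inter> unit_cube. ?w x = k" if S: "S \<in> \<S>" for S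
  proof -
    have "\<exists>g b. (\<forall>x\<in>S \<inter> unit_cube. \<phi> p x = g \<bullet> x + b) \<and> (\<forall>x\<in>interior S. grad (\<phi> p) x = g)" for p
      using affine_pieces[OF \<phi>[of p]] S by metis
    then obtain g b where g: "\<And>p x. x \<in> S \<inter> unit_cube \<Longrightarrow> \<phi> p x = g p \<bullet> x + b p"
      "\<And>p x. x \<in> interior S \<Longrightarrow> grad (\<phi> p) x = g p"
      by metis
    \<comment> \<open>A nonempty open set is not null, so the gradient vanishes at some interior
      point, and it is constant on the interior.\<close>
    have "\<not> interior S \<subseteq> {x \<in> closure unit_cube. (\<Sum>p\<in>UNIV. v $ p *\<^sub>R grad (\<phi> p) x) \<noteq> 0}"
      using open_not_negligible[OF open_interior mesh(4)[OF S]] negligible_subset[OF null] by blast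
    then obtain x where "x \<in> interior S" "(\<Sum>p\<in>UNIV. v $ p *\<^sub>R grad (\<phi> p) x) = 0"
      using mesh(5)[OF S] closure_subset by blast
    then have zero: "(\<Sum>p\<in>UNIV. v $ p *\<^sub>R g p) = 0"
      by (simp add: g)
    have "?w y = (\<Sum>p\<in>UNIV. v $ p * b p)" if "y \<in> S \<inter> unit_cube" for y
    proof -
      have "?w y = (\<Sum>p\<in>UNIV. v $ p *\<^sub>R g p) \<bullet> y + (\<Sum>p\<in>UNIV. v $ p * b p)"
        using that by (simp add: g inner_sum_left sum.distrib distrib_left)
      then show ?thesis
        by (simp add: zero)
    qed
    then show ?thesis
      by blast
  qed
  then obtain k where k: "\<And>S x. S \<in> \<S> \<Longrightarrow> x \<in> S \<inter> unit_cube \<Longrightarrow> ?w x = k S"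
    by metis
  have "?w ` unit_cube \<subseteq> k ` \<S>"
    using k mesh(6) closure_subset[of unit_cube] by fastforce
  then have "finite (?w ` unit_cube)"
    using mesh(1) by (meson finite_imageI finite_subset)
  moreover have "connected (?w ` unit_cube)"
    using \<phi> by (intro connected_continuous_image continuous_intros)
      (auto simp: pw_affine_space_def unit_cube_def intro: convex_connected convex_box)
  ultimately have "?w ` unit_cube = {} \<or> (\<exists>r. ?w ` unit_cube = {r})"
    using connected_finite_iff_sing by blast
  then obtain r where r: "\<And>x. x \<in> unit_cube \<Longrightarrow> ?w x = r"
    by blast
  have "(LINT x:unit_cube|lebesgue. ?w x) = (\<Sum>p\<in>UNIV. v $ p * (LINT x:unit_cube|lebesgue. \<phi> p x))"
  proof -
    have "integrable lebesgue (\<lambda>x. indicator unit_cube x * \<phi> p x)" for p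
      using integrable_on_cube[OF \<phi>[of p]] by (simp add: set_integrable_def)
    then show ?thesis
      unfolding set_lebesgue_integral_def
      by (simp add: sum_distrib_left mult.left_commute Bochner_Integration.integral_sum)
  qed
  also have "\<dots> = 0"
    using \<phi> by (simp add: pw_affine_space_def)
  also have "(LINT x:unit_cube|lebesgue. ?w x) = (LINT x:(unit_cube::(real^'d) set)|lebesgue. r)"
    using r unit_cube_measurable(1) by (intro set_lebesgue_integral_cong) auto
  also have "\<dots> = measure lebesgue (unit_cube::(real^'d) set) * r"
    using unit_cube_measurable(1) by (simp add: set_lebesgue_integral_def)
  finally have "measure lebesgue (unit_cube::(real^'d) set) * r = 0"
    by simp
  moreover have "measure lebesgue (unit_cube::(real^'d) set) \<noteq> 0"
    using unit_cube_measurable open_not_negligible[of "unit_cube::(real^'d) set"] interval_ne_empty_cart(2)[of "0::real^'d" 1]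
    by (auto simp: unit_cube_def negligible_iff_measure)
  ultimately have "r = 0"
    by simp
  then have v: "\<forall>x\<in>unit_cube. 0 = (\<Sum>p\<in>UNIV. v $ p * \<phi> p x)"
    using r by simp
  have "(\<lambda>x. 0) \<in> pw_affine_space \<S>"
    unfolding pw_affine_space_def by (auto intro!: exI[of _ 0])
  then have "\<exists>!c :: real^'m. \<forall>x\<in>unit_cube. 0 = (\<Sum>p\<in>UNIV. c $ p * \<phi> p x)"
    by (rule bspec[OF conjunct2[OF basis[unfolded basis_on_cube_def]]])
  then obtain c where c: "\<And>c'. \<forall>x\<in>unit_cube. 0 = (\<Sum>p\<in>UNIV. c' $ p * \<phi> p x) \<Longrightarrow> c' = c"
    by (elim ex1E) blast
  show ?thesis
    using c[OF v] c[of 0] by simp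
qed

end

section \<open>The stiffness matrices of a triangulation\<close>

lemma local_stiffness_sym: "v \<bullet> (local_stiffness X \<phi> *v w) = w \<bullet> (local_stiffness X \<phi> *v v)"
proof -
  have "transpose (local_stiffness X \<phi>) = local_stiffness X \<phi>"
    by (simp add: transpose_def local_stiffness_def vec_eq_iff inner_commute)
  then show ?thesis
    by (metis dot_lmul_matrix inner_commute vector_transpose_matrix)
qed

text \<open>Definiteness is the substantial part: the coarse simplices cover the closed cube, so if
  all local energies vanish, the gradient of the combination is zero almost everywhere.\<close>

lemma discrete_energy_local_stiffness:
  fixes T :: "'N::finite \<Rightarrow> (real^'d::finite) set" and \<phi> :: "'m::finite \<Rightarrow> real^'d \<Rightarrow> real"
  assumes coarse: "simplicial_triangulation_of_cube \<T>" and T: "bij_betw T UNIV \<T>"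
    and fine: "simplicial_triangulation_of_cube \<S>"
    and basis: "basis_on_cube \<phi> (pw_affine_space \<S>)"
    and "0 < \<delta>"
  shows "discrete_energy (\<lambda>i. local_stiffness (T i) \<phi>) \<delta> (\<chi> i. measure lebesgue (T i))"
proof
  interpret fine_mesh \<S>
    by (rule fine_mesh.intro[OF fine])
  note coarse = simplicial_triangulation_of_cubeD[OF coarse]
  have in_mesh: "T i \<in> \<T>" for i
    using T by (auto simp: bij_betw_def)
  have T_meas: "T i \<in> lmeasurable" for i
    using coarse(3)[OF in_mesh] by (rule lmeasurable_compact)
  then have T_sets: "T i \<in> sets lebesgue" for i
    by (rule fmeasurableD)
  have T_sub: "T i \<subseteq> closure unit_cube" for i
    using coarse(6) in_mesh by blast
  have \<phi>: "\<phi> p \<in> pw_affine_space \<S>" for p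
    using basis by (simp add: basis_on_cube_def)
  note form = local_stiffness_form[of \<phi>, OF \<phi> T_sets T_sub]
  show "0 < \<delta>"
    by fact
  show "0 < (\<chi> i. measure lebesgue (T i)) $ i" for i
  proof -
    have "\<not> negligible (T i)"
      using open_not_negligible[OF open_interior coarse(4)[OF in_mesh]] interior_subset negligible_subset
      by metis
    then show ?thesis
      using T_meas[of i] by (simp add: negligible_iff_measure zero_less_measure_iff)
  qed
  show "v \<bullet> (local_stiffness (T i) \<phi> *v w) = w \<bullet> (local_stiffness (T i) \<phi> *v v)" for v w i
    by (rule local_stiffness_sym)
  show "0 \<le> v \<bullet> (local_stiffness (T i) \<phi> *v v)" for v i
    unfolding form(2) set_lebesgue_integral_def by (intro integral_nonneg_AE) auto
  show "v = 0" if zero: "\<And>i. v \<bullet> (local_stiffness (T i) \<phi> *v v) = 0" for v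
  proof (rule gradient_free_imp_zero[OF basis])
    let ?W = "\<lambda>x. \<Sum>p\<in>UNIV. v $ p *\<^sub>R grad (\<phi> p) x"
    have "negligible {x \<in> T i. ?W x \<noteq> 0}" for i
    proof -
      have "(\<integral>x. indicator (T i) x *\<^sub>R (norm (?W x))\<^sup>2 \<partial>lebesgue) = 0"
        using zero[of i] unfolding form(2) set_lebesgue_integral_def .
      \<comment> \<open>Uses integrability as well as nonnegativity: the integral of a nonintegrable
        function is 0 by convention.\<close>
      then have "AE x in lebesgue. indicator (T i) x *\<^sub>R (norm (?W x))\<^sup>2 = 0"
        using form(1)[of i v] unfolding set_integrable_def
        by (subst (asm) integral_nonneg_eq_0_iff_AE) auto
      then have "AE x in lebesgue. x \<notin> {x \<in> T i. ?W x \<noteq> 0}"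
        by (rule AE_mp) (auto simp: indicator_def)
      then show ?thesis
        by (simp add: negligible_iff_null_sets AE_iff_null_sets completion.AE_iff_null_sets)
    qed
    then have "negligible (\<Union>i. {x \<in> T i. ?W x \<noteq> 0})"
      by (intro negligible_Union) auto
    moreover have "(\<Union>i. {x \<in> T i. ?W x \<noteq> 0}) = {x \<in> closure unit_cube. ?W x \<noteq> 0}"
      using T coarse(6) by (auto simp: bij_betw_def)
    ultimately show "negligible {x \<in> closure unit_cube. ?W x \<noteq> 0}"
      by simp
  qed
qed

text \<open>Convergence of Newton's method is part of the conclusion so that
  \<open>exact_step\<close> is meaningful. The estimate is conditional on
  \<open>newton_stops\<close> because the least stopping index is arbitrary when none
  exists.\<close>

theorem proposition5p2:
  fixes f :: "real^'d::finite \<Rightarrow> real"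
    and \<T> :: "nat \<Rightarrow> (real^'d) set set"
    and \<delta> :: "nat \<Rightarrow> real"
    and n :: nat
    and T :: "'N::finite \<Rightarrow> (real^'d) set"
    and \<phi> :: "'m::finite \<Rightarrow> real^'d \<Rightarrow> real"
    and E F :: "real^'N \<Rightarrow> real"
    and c :: real
  assumes "admissible_source f"
    and "uniformly_refined_triangulations \<T>"
    and "decseq \<delta>" and "\<And>k. \<delta> k > 0" and "\<delta> \<longlonglongrightarrow> 0"
    and "bij_betw T UNIV (\<T> n)"
    and "basis_on_cube \<phi> (pw_affine_space (\<T> (Suc n)))"
    and "E = energy f T \<phi> (\<delta> n)"
    and "F = (\<lambda>\<sigma>. E (sq \<sigma>))"
    and "\<exists>\<sigma>m. is_arg_min F (\<lambda>_. True) \<sigma>m \<and> F \<sigma>m < c"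
  shows "\<exists>\<tau>s>0. euler_newton_consistent E c \<tau>s \<and>
    (\<forall>\<tau>. 0 < \<tau> \<and> \<tau> < \<tau>s \<longrightarrow>
      (\<exists>\<epsilon>s>0. \<forall>\<epsilon>. 0 < \<epsilon> \<and> \<epsilon> \<le> \<epsilon>s \<longrightarrow>
        (\<forall>\<sigma>. F \<sigma> < c \<longrightarrow>
          newton_converges F \<tau> \<sigma> \<and>
          (newton_stops F \<epsilon> \<tau> \<sigma> \<longrightarrow>
            F \<sigma> - F (inexact_step F \<epsilon> \<tau> \<sigma>) \<ge> (F \<sigma> - F (exact_step F \<tau> \<sigma>)) / 2))))"
proof -
  interpret discrete_energy "\<lambda>i. local_stiffness (T i) \<phi>" "\<delta> n" "load f \<phi>"
      "\<chi> i. measure lebesgue (T i)"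
    using assms(2,4,6,7)
    by (intro discrete_energy_local_stiffness) (auto simp: uniformly_refined_triangulations_def)
  have "E = J"
    by (simp add: assms(8) fun_eq_iff energy_def J_def u_def A_def stiffness_def)
  then interpret convex_energy E F "\<lambda>\<mu>. \<chi> i. measure lebesgue (T i)
      - u \<mu> \<bullet> (local_stiffness (T i) \<phi> *v u \<mu>)" "\<chi> i. measure lebesgue (T i)" "1 / \<delta> n"
    using J_convex_energy assms(9) by simp
  show ?thesis
    by (rule backward_euler_newton)
qed

end
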